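(* There exists a positive $f \in \mathcal{A}_{\emptyset}$ which is not CS-positive.
   Context: All graphs are finite and simple; $\emptyset$ denotes the graph with no vertices. A partially labeled graph is a graph in which some vertices carry distinct positive-integer labels. $\mathcal{F}$ is the set of partially labeled graphs up to label-preserving isomorphism, and $\mathcal{F}_L$ those whose label set is exactly the finite set $L\subset\mathbb{N}$. The product $H_1\cdot H_2$ is the disjoint union with equally labeled vertices identified (multiple edges merged). $\mathbb{R}[\mathcal{F}]$ is the algebra of finite formal real linear combinations of elements of $\mathcal{F}$ with this product extended bilinearly, and $\mathbb{R}[\mathcal{F}_L]$ the subalgebra spanned by $\mathcal{F}_L$. For $H\in\mathcal{F}_L$, a graph $G$ and $\phi:L\to V(G)$, $t(H;G,\phi)$ is the probability that the map sending each labeled vertex with label $\ell$ to $\phi(\ell)$ and each unlabeled vertex to an independent uniform random vertex of $G$ is a homomorphism; this is extended linearly. Let $\mathcal{K}$ be the ideal generated by $F-\emptyset$ for $F$ a one-vertex (labeled or unlabeled) graph; $\mathcal{A}=\mathbb{R}[\mathcal{F}]/\mathcal{K}$, $\mathcal{A}_L=\mathbb{R}[\mathcal{F}_L]/(\mathcal{K}\cap\mathbb{R}[\mathcal{F}_L])$. An element $f\in\mathcal{A}_L$ is positive if $t(f;G,\phi)\ge0$ for all graphs $G$ and all $\phi:L\to V(G)$. For finite $T\subset\mathbb{N}$, $\llbracket\cdot\rrbracket_T$ is the linear map removing all labels not in $T$. The Cauchy-Schwarz calculus operates with statements $f\ge0$, $f\in\mathcal{A}$, with axioms (A1) $f^2\ge0$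 for every $f\in\mathcal{A}$; (A2) $\llbracket f_1^2\rrbracket_T\llbracket f_2^2\rrbracket_T-\llbracket f_1f_2\rrbracket_T^2\ge0$ for every finite $L\subset\mathbb{N}$, $f_1,f_2\in\mathcal{A}_L$ and $T\subseteq L$; and inference rules (R1) from $f\ge0$ and $g\ge0$ infer $\alpha f+\beta g\ge0$ for $\alpha,\beta\ge0$; (R2) from $f\ge0$ and $g\ge0$ infer $fg\ge0$; (R3) from $f\ge0$ infer $\llbracket f\rrbracket_T\ge0$ for any finite $T\subseteq\mathbb{N}$. An element $f\in\mathcal{A}$ is CS-positive if $f\ge0$ is provable in this calculus. *)

theory Defs
  imports Complex_Main "HOL-Library.FuncSet"
begin

text \<open>A partially labeled graph: a finite vertex set of naturals, a set of edges
 (2-element subsets of the vertex set), and a partial labeling of vertices by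
 distinct positive integers.  The set F of the paper is the set of these up to
 label-preserving isomorphism; we work with representatives and quotient at the
 level of the algebra (see the ideal J below).\<close>

record plg =
  pV :: "nat set"
  pE :: "nat set set"
  plab :: "nat \<Rightarrow> nat option"

definition wf_plg :: "plg \<Rightarrow> bool" where
  "wf_plg H \<longleftrightarrow> finite (pV H)
     \<and> (\<forall>e\<in>pE H. e \<subseteq> pV H \<and> card e = 2)
     \<and> (\<forall>v. v \<notin> pV H \<longrightarrow> plab H v = None)
     \<and> inj_on (plab H) {v \<in> pV H. plab H v \<noteq> None}
     \<and> (\<forall>v l. plab H v = Some l \<longrightarrow> l \<ge> 1)"

definition labels :: "plg \<Rightarrow> nat set" where
  "labels H = {l. \<exists>v\<in>pV H. plab H v = Some l}"

definition empty_plg :: plg where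
  "empty_plg = \<lparr>pV = {}, pE = {}, plab = (\<lambda>_. None)\<rparr>"

definition plg_iso :: "plg \<Rightarrow> plg \<Rightarrow> bool" where
  "plg_iso H H' \<longleftrightarrow> (\<exists>h. bij_betw h (pV H) (pV H')
      \<and> (\<lambda>e. h ` e) ` pE H = pE H'
      \<and> (\<forall>v\<in>pV H. plab H' (h v) = plab H v))"

text \<open>Product of partially labeled graphs: disjoint union, equally labeled
 vertices identified, multiple edges merged.  Vertices of H1 are sent to even
 numbers, unmatched vertices of H2 to odd numbers.\<close>

definition prod_map2 :: "plg \<Rightarrow> plg \<Rightarrow> nat \<Rightarrow> nat" where
  "prod_map2 H1 H2 v =
     (if plab H2 v \<noteq> None \<and> (\<exists>u\<in>pV H1. plab H1 u = plab H2 v)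
      then 2 * (THE u. u \<in> pV H1 \<and> plab H1 u = plab H2 v)
      else 2 * v + 1)"

definition plg_mult :: "plg \<Rightarrow> plg \<Rightarrow> plg" where
  "plg_mult H1 H2 =
     (let m1 = (\<lambda>u::nat. 2 * u); m2 = prod_map2 H1 H2;
          V = m1 ` pV H1 \<union> m2 ` pV H2
      in \<lparr>pV = V,
          pE = (\<lambda>e. m1 ` e) ` pE H1 \<union> (\<lambda>e. m2 ` e) ` pE H2,
          plab = (\<lambda>w. if w \<notin> V then None
                      else if even w then plab H1 (w div 2) else plab H2 (w div 2))\<rparr>)"

definition plg_unlabel :: "nat set \<Rightarrow> plg \<Rightarrow> plg" where
  "plg_unlabel T H = H\<lparr>plab := (\<lambda>v. case plab H v of None \<Rightarrow> None
                                     | Some l \<Rightarrow> if l \<in> T then Some l else None)\<rparr>"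

definition supp :: "(plg \<Rightarrow> real) \<Rightarrow> plg set" where
  "supp f = {H. f H \<noteq> 0}"

definition is_el :: "(plg \<Rightarrow> real) \<Rightarrow> bool" where
  "is_el f \<longleftrightarrow> finite (supp f) \<and> (\<forall>H\<in>supp f. wf_plg H)"

definition delta :: "plg \<Rightarrow> plg \<Rightarrow> real" where
  "delta H = (\<lambda>H'. if H' = H then 1 else 0)"

definition pmul :: "(plg \<Rightarrow> real) \<Rightarrow> (plg \<Rightarrow> real) \<Rightarrow> plg \<Rightarrow> real" where
  "pmul f g = (\<lambda>H. \<Sum>p\<in>{p \<in> supp f \<times> supp g. plg_mult (fst p) (snd p) = H}.
                      f (fst p) * g (snd p))"

definition unlabel :: "nat set \<Rightarrow> (plg \<Rightarrow> real) \<Rightarrow> plg \<Rightarrow> real" where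
  "unlabel T f = (\<lambda>H. \<Sum>H'\<in>{H' \<in> supp f. plg_unlabel T H' = H}. f H')"

definition in_FL :: "nat set \<Rightarrow> (plg \<Rightarrow> real) \<Rightarrow> bool" where
  "in_FL L f \<longleftrightarrow> (\<forall>H\<in>supp f. labels H = L)"

text \<open>The ideal J of the representative algebra generated by differences of
 isomorphic graphs (passing to R[F]) and by F - empty for one-vertex F (the
 ideal K).  The algebra A is the quotient by J.\<close>

inductive_set J_ideal :: "(plg \<Rightarrow> real) set" where
  iso_gen: "wf_plg H \<Longrightarrow> wf_plg H' \<Longrightarrow> plg_iso H H'
              \<Longrightarrow> (\<lambda>X. delta H X - delta H' X) \<in> J_ideal"
| one_vertex: "wf_plg F \<Longrightarrow> card (pV F) = 1
              \<Longrightarrow> (\<lambda>X. delta F X - delta empty_plg X) \<in> J_ideal"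
| zero: "(\<lambda>_. 0) \<in> J_ideal"
| add: "f \<in> J_ideal \<Longrightarrow> g \<in> J_ideal \<Longrightarrow> (\<lambda>X. f X + g X) \<in> J_ideal"
| smult: "f \<in> J_ideal \<Longrightarrow> (\<lambda>X. c * f X) \<in> J_ideal"
| mult_left: "f \<in> J_ideal \<Longrightarrow> is_el g \<Longrightarrow> pmul g f \<in> J_ideal"
| mult_right: "f \<in> J_ideal \<Longrightarrow> is_el g \<Longrightarrow> pmul f g \<in> J_ideal"

definition sgraph :: "nat set \<Rightarrow> nat set set \<Rightarrow> bool" where
  "sgraph VG EG \<longleftrightarrow> finite VG \<and> (\<forall>e\<in>EG. e \<subseteq> VG \<and> card e = 2)"

definition is_hom :: "plg \<Rightarrow> nat set set \<Rightarrow> (nat \<Rightarrow> nat) \<Rightarrow> bool" where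
  "is_hom H EG m \<longleftrightarrow> (\<forall>e\<in>pE H. m ` e \<in> EG)"

definition unlabeled_vertices :: "plg \<Rightarrow> nat set" where
  "unlabeled_vertices H = {v \<in> pV H. plab H v = None}"

definition tdens :: "plg \<Rightarrow> nat set \<Rightarrow> nat set set \<Rightarrow> (nat \<Rightarrow> nat) \<Rightarrow> real" where
  "tdens H VG EG \<phi> =
     real (card {\<psi> \<in> unlabeled_vertices H \<rightarrow>\<^sub>E VG.
              is_hom H EG (\<lambda>v. case plab H v of Some l \<Rightarrow> \<phi> l | None \<Rightarrow> \<psi> v)})
     / real (card VG) ^ card (unlabeled_vertices H)"

definition tdens_el :: "(plg \<Rightarrow> real) \<Rightarrow> nat set \<Rightarrow> nat set set \<Rightarrow> (nat \<Rightarrow> nat) \<Rightarrow> real" where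
  "tdens_el f VG EG \<phi> = (\<Sum>H\<in>supp f. f H * tdens H VG EG \<phi>)"

text \<open>Positivity of an element of A_L (given by a representative in R[F_L]).\<close>
definition positive :: "nat set \<Rightarrow> (plg \<Rightarrow> real) \<Rightarrow> bool" where
  "positive L f \<longleftrightarrow> (\<forall>VG EG \<phi>. sgraph VG EG \<and> VG \<noteq> {} \<and> \<phi> ` L \<subseteq> VG
                        \<longrightarrow> tdens_el f VG EG \<phi> \<ge> 0)"

text \<open>The set of (representatives of) CS-positive elements: the elements f for
 which f >= 0 is derivable.  The last rule makes it a set of classes in A.\<close>

inductive_set CSpos :: "(plg \<Rightarrow> real) set" where
  A1: "is_el f \<Longrightarrow> pmul f f \<in> CSpos"
| A2: "finite L \<Longrightarrow> is_el f1 \<Longrightarrow> is_el f2 \<Longrightarrow> in_FL L f1 \<Longrightarrow> in_FL L f2 \<Longrightarrow> T \<subseteq> L \<Longrightarrow>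
       (\<lambda>X. pmul (unlabel T (pmul f1 f1)) (unlabel T (pmul f2 f2)) X
            - pmul (unlabel T (pmul f1 f2)) (unlabel T (pmul f1 f2)) X) \<in> CSpos"
| R1: "f \<in> CSpos \<Longrightarrow> g \<in> CSpos \<Longrightarrow> (\<alpha>::real) \<ge> 0 \<Longrightarrow> (\<beta>::real) \<ge> 0 \<Longrightarrow>
       (\<lambda>X. \<alpha> * f X + \<beta> * g X) \<in> CSpos"
| R2: "f \<in> CSpos \<Longrightarrow> g \<in> CSpos \<Longrightarrow> pmul f g \<in> CSpos"
| R3: "f \<in> CSpos \<Longrightarrow> finite T \<Longrightarrow> unlabel T f \<in> CSpos"
| congr: "f \<in> CSpos \<Longrightarrow> is_el g \<Longrightarrow> (\<lambda>X. f X - g X) \<in> J_ideal \<Longrightarrow> g \<in> CSpos"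

end

theory Submission
  imports Defs "HOL-Computational_Algebra.Polynomial" "Jordan_Normal_Form.Schur_Decomposition"
begin

text \<open>
  Let \<open>p\<^sub>k\<close> be the density of the \<open>k\<close>-cycle (an edge for \<open>k = 2\<close>), which is the \<open>k\<close>-th power sum of the
  eigenvalues of the normalized adjacency matrix.  The element
  \<open>(2 p\<^sub>3\<^sup>2 p\<^sub>2\<^sup>3 - 2 p\<^sub>2\<^sup>2 p\<^sub>4\<^sup>2 - p\<^sub>4\<^sup>3)\<^sup>2 - p\<^sub>4\<^sup>6 / 2 + C (p\<^sub>2 p\<^sub>6 - p\<^sub>4\<^sup>2)\<close> is positive for large \<open>C\<close>: if
  \<open>p\<^sub>2 p\<^sub>6 - p\<^sub>4\<^sup>2 = 0\<close> then all nonzero eigenvalues are \<open>\<plusminus>\<alpha>\<close>, and if \<open>+\<alpha>\<close> and \<open>-\<alpha>\<close> have multiplicities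
  \<open>a\<close> and \<open>b\<close>, then the first square is \<open>p\<^sub>4\<^sup>6 (2 (a - b)\<^sup>2 - 2 (a + b) - 1)\<^sup>2 \<ge> p\<^sub>4\<^sup>6\<close>, an odd integer being
  squared.  A quantitative version of this argument covers the other graphs.

  The calculus does not see the integrality.  Consider \<open>n\<close> disjoint edges together with \<open>\<nu>\<close> isolated loops,
  all vertices having the same weight.  Densities in this graph are rational functions of \<open>\<nu>\<close>, so they
  make sense for real \<open>\<nu>\<close>; averaging over a vertex puts weight on the edges, on the loops carrying labels,
  and weight proportional to \<open>\<nu>\<close> minus the number of the latter on a fresh loop.  Hence a derivation remains
  valid for all real \<open>\<nu>\<close> exceeding the number of labels it uses.  But here \<open>a - b = \<nu>\<close> and
  \<open>a + b = 2 n + \<nu>\<close>, and the element is negative if \<open>2 \<nu>\<^sup>2 - 2 (2 n + \<nu>) - 1 = 0\<close>, which has arbitrarily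
  large solutions \<open>\<nu>\<close>.
\<close>

section \<open>The algebra of partially labeled graphs\<close>

definition lin :: "(plg \<Rightarrow> real) \<Rightarrow> (plg \<Rightarrow> real) \<Rightarrow> real" where
  "lin v f = (\<Sum>H\<in>supp f. f H * v H)"

lemma lin_superset: "finite S \<Longrightarrow> supp f \<subseteq> S \<Longrightarrow> lin v f = (\<Sum>H\<in>S. f H * v H)"
  unfolding lin_def by (rule sum.mono_neutral_left) (auto simp: supp_def)

lemma supp_delta: "supp (delta H) = {H}"
  by (auto simp: supp_def delta_def)

lemma supp_lincomb: "supp (\<lambda>X. a * f X + b * g X) \<subseteq> supp f \<union> supp g"
  by (auto simp: supp_def)

lemma supp_pmul: "supp (pmul f g) \<subseteq> (\<lambda>p. plg_mult (fst p) (snd p)) ` (supp f \<times> supp g)"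
proof
  fix H assume "H \<in> supp (pmul f g)"
  then have "pmul f g H \<noteq> 0" by (simp add: supp_def)
  then have "{p \<in> supp f \<times> supp g. plg_mult (fst p) (snd p) = H} \<noteq> {}"
    unfolding pmul_def by (metis (no_types, lifting) sum.empty)
  then show "H \<in> (\<lambda>p. plg_mult (fst p) (snd p)) ` (supp f \<times> supp g)" by blast
qed

lemma supp_unlabel: "supp (unlabel T f) \<subseteq> plg_unlabel T ` supp f"
proof
  fix H assume "H \<in> supp (unlabel T f)"
  then have "unlabel T f H \<noteq> 0" by (simp add: supp_def)
  then have "{H' \<in> supp f. plg_unlabel T H' = H} \<noteq> {}"
    unfolding unlabel_def by (metis (no_types, lifting) sum.empty)
  then show "H \<in> plg_unlabel T ` supp f" by blast
qed

lemma lin_lincomb: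
  assumes "finite (supp f)" "finite (supp g)"
  shows "lin v (\<lambda>X. a * f X + b * g X) = a * lin v f + b * lin v g"
proof -
  let ?S = "supp f \<union> supp g"
  have "lin v (\<lambda>X. a * f X + b * g X) = (\<Sum>H\<in>?S. (a * f H + b * g H) * v H)"
    using assms supp_lincomb by (intro lin_superset) auto
  also have "\<dots> = a * (\<Sum>H\<in>?S. f H * v H) + b * (\<Sum>H\<in>?S. g H * v H)"
    by (simp add: sum_distrib_left sum.distrib algebra_simps)
  also have "(\<Sum>H\<in>?S. f H * v H) = lin v f"
    using assms by (intro lin_superset [symmetric]) auto
  also have "(\<Sum>H\<in>?S. g H * v H) = lin v g"
    using assms by (intro lin_superset [symmetric]) auto
  finally show ?thesis .
qed

lemma lin_delta: "lin v (delta H) = v H"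
  by (simp add: lin_def supp_delta) (simp add: delta_def)

text \<open>placeholder

  \<open>H\<close> for the product stands for a whole fibre here: distinct pairs of graphs can have
  the same product, so the coefficients are grouped by their product.\<close>

lemma lin_pmul_sum:
  assumes "finite (supp f)" "finite (supp g)"
  shows "lin v (pmul f g) = (\<Sum>p\<in>supp f \<times> supp g. f (fst p) * g (snd p) * v (plg_mult (fst p) (snd p)))"
proof -
  let ?m = "\<lambda>p. plg_mult (fst p) (snd p)" and ?P = "supp f \<times> supp g"
  have "lin v (pmul f g) = (\<Sum>H\<in>?m ` ?P. pmul f g H * v H)"
    using assms supp_pmul by (intro lin_superset) auto
  also have "\<dots> = (\<Sum>H\<in>?m ` ?P. \<Sum>p\<in>{p \<in> ?P. ?m p = H}. f (fst p) * g (snd p) * v (?m p))"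
    unfolding pmul_def sum_distrib_right by (intro sum.cong) auto
  also have "\<dots> = (\<Sum>p\<in>?P. f (fst p) * g (snd p) * v (?m p))"
    using assms by (intro sum.group) auto
  finally show ?thesis .
qed

text \<open>Multiplicativity extends bilinearly. It is asked for on the supports only, because
  densities multiply only for well-formed graphs.\<close>

lemma lin_pmul:
  assumes "finite (supp f)" "finite (supp g)"
    and "\<And>H H'. H \<in> supp f \<Longrightarrow> H' \<in> supp g \<Longrightarrow> v (plg_mult H H') = v H * v H'"
  shows "lin v (pmul f g) = lin v f * lin v g"
proof -
  have "lin v (pmul f g) = (\<Sum>p\<in>supp f \<times> supp g. (f (fst p) * v (fst p)) * (g (snd p) * v (snd p)))"
    unfolding lin_pmul_sum [OF assms(1,2)] by (intro sum.cong) (auto simp: assms(3))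
  also have "\<dots> = lin v f * lin v g"
    unfolding lin_def sum_product by (simp add: sum.cartesian_product case_prod_beta)
  finally show ?thesis .
qed

lemma lin_unlabel:
  assumes "finite (supp f)"
  shows "lin v (unlabel T f) = lin (\<lambda>H. v (plg_unlabel T H)) f"
proof -
  let ?m = "plg_unlabel T"
  have "lin v (unlabel T f) = (\<Sum>H\<in>?m ` supp f. unlabel T f H * v H)"
    using assms supp_unlabel by (intro lin_superset) auto
  also have "\<dots> = (\<Sum>H\<in>?m ` supp f. \<Sum>H'\<in>{H' \<in> supp f. ?m H' = H}. f H' * v (?m H'))"
    unfolding unlabel_def sum_distrib_right by (intro sum.cong) auto
  also have "\<dots> = (\<Sum>H\<in>supp f. f H * v (?m H))"
    using assms by (intro sum.group) auto
  finally show ?thesis by (simp add: lin_def)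
qed

section \<open>Removing labels\<close>

lemma wf_plg_unlabel: "wf_plg H \<Longrightarrow> wf_plg (plg_unlabel T H)"
  unfolding wf_plg_def plg_unlabel_def inj_on_def
  by (auto split: option.splits if_splits)

lemma labels_plg_unlabel: "labels (plg_unlabel T H) = labels H \<inter> T"
  unfolding labels_def plg_unlabel_def by (auto split: option.splits if_splits)

lemma plg_unlabel_plg_unlabel: "plg_unlabel S (plg_unlabel T H) = plg_unlabel (S \<inter> T) H"
  by (cases H) (auto simp: plg_unlabel_def fun_eq_iff split: option.splits)

text \<open>Only the labels that occur in \<open>H\<close> matter. Keeping \<open>T\<close> can
  therefore be replaced by deleting a finite set of labels, one at a time.\<close>

lemma plg_unlabel_cong:
  assumes "wf_plg H" "labels H \<inter> S = labels H \<inter> T"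
  shows "plg_unlabel S H = plg_unlabel T H"
proof -
  have "l \<in> S \<longleftrightarrow> l \<in> T" if "plab H v = Some l" for v l
  proof -
    have "v \<in> pV H" using that assms(1) by (auto simp: wf_plg_def)
    then have "l \<in> labels H" using that by (auto simp: labels_def)
    then show ?thesis using assms(2) by blast
  qed
  then show ?thesis
    by (cases H) (auto simp: plg_unlabel_def fun_eq_iff split: option.splits)
qed

lemma finite_labels: "wf_plg H \<Longrightarrow> finite (labels H)"
proof -
  assume "wf_plg H"
  then have "finite (pV H)" by (simp add: wf_plg_def)
  moreover have "labels H \<subseteq> (\<lambda>v. the (plab H v)) ` pV H"
    by (force simp: labels_def)
  ultimately show ?thesis by (rule finite_surj)
qed

section \<open>Vertices, labels and edges of a product\<close>

lemma prod_map2_matched: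
  assumes "wf_plg H1" "u \<in> pV H1" "plab H1 u = Some l" "plab H2 v = Some l"
  shows "prod_map2 H1 H2 v = 2 * u"
proof -
  have "(THE u. u \<in> pV H1 \<and> plab H1 u = plab H2 v) = u"
    using assms by (intro the_equality) (auto simp: wf_plg_def inj_on_def)
  then show ?thesis using assms by (auto simp: prod_map2_def)
qed

lemma prod_map2_unmatched:
  assumes "\<And>l. plab H2 v = Some l \<Longrightarrow> l \<notin> labels H1"
  shows "prod_map2 H1 H2 v = 2 * v + 1"
proof -
  have "\<not> (plab H2 v \<noteq> None \<and> (\<exists>u\<in>pV H1. plab H1 u = plab H2 v))"
    using assms by (auto simp: labels_def)
  then show ?thesis unfolding prod_map2_def by (simp only: if_False)
qed

lemma prod_map2_cases:
  assumes "wf_plg H1"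
  obtains (matched) u l where "u \<in> pV H1" "plab H1 u = Some l" "plab H2 v = Some l"
      "prod_map2 H1 H2 v = 2 * u"
  | (unmatched) "\<And>l. plab H2 v = Some l \<Longrightarrow> l \<notin> labels H1" "prod_map2 H1 H2 v = 2 * v + 1"
proof (cases "\<exists>l. plab H2 v = Some l \<and> l \<in> labels H1")
  case True
  then show ?thesis using prod_map2_matched [OF assms] matched by (auto simp: labels_def)
next
  case False
  then show ?thesis using prod_map2_unmatched unmatched by metis
qed

text \<open>Parity separates matched from unmatched vertices, and two matched vertices with the same
  image carry the label of that image, hence coincide. Injectivity keeps the two ends of an edge
  distinct in the product.\<close>

lemma inj_on_prod_map2:
  assumes "wf_plg H1" "wf_plg H2"
  shows "inj_on (prod_map2 H1 H2) (pV H2)"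
proof (rule inj_onI)
  fix v w assume *: "v \<in> pV H2" "w \<in> pV H2" "prod_map2 H1 H2 v = prod_map2 H1 H2 w"
  have inj: "inj_on (plab H2) {v \<in> pV H2. plab H2 v \<noteq> None}"
    using assms by (simp add: wf_plg_def)
  show "v = w"
  proof (rule prod_map2_cases [OF assms(1), of H2 v], goal_cases matched unmatched)
    case (matched u l)
    note m = matched
    show ?thesis
    proof (rule prod_map2_cases [OF assms(1), of H2 w], goal_cases matched unmatched)
      case (matched u' l')
      then show ?thesis using m * inj by (auto simp: inj_on_def)
    next
      case unmatched
      then show ?thesis using m * by presburger
    qed
  next
    case unmatched
    note m = unmatched
    show ?thesis
    proof (rule prod_map2_cases [OF assms(1), of H2 w], goal_cases matched unmatched)
      case (matched u' l')
      then show ?thesis using m * by presburger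
    next
      case unmatched
      then show ?thesis using m * by presburger
    qed
  qed
qed

lemma pV_plg_mult: "pV (plg_mult H1 H2) = (\<lambda>u. 2 * u) ` pV H1 \<union> prod_map2 H1 H2 ` pV H2"
  by (simp add: plg_mult_def Let_def)

lemma pE_plg_mult:
  "pE (plg_mult H1 H2) = (\<lambda>e. (\<lambda>u. 2 * u) ` e) ` pE H1 \<union> (\<lambda>e. prod_map2 H1 H2 ` e) ` pE H2"
  by (simp add: plg_mult_def Let_def)

lemma plab_plg_mult_left: "u \<in> pV H1 \<Longrightarrow> plab (plg_mult H1 H2) (2 * u) = plab H1 u"
  by (auto simp: plg_mult_def Let_def)

lemma plab_plg_mult_right:
  assumes "wf_plg H1" "v \<in> pV H2"
  shows "plab (plg_mult H1 H2) (prod_map2 H1 H2 v) = plab H2 v"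
proof (rule prod_map2_cases [OF assms(1), of H2 v], goal_cases matched unmatched)
  case (matched u l)
  then show ?thesis by (simp add: plab_plg_mult_left)
next
  case unmatched
  then have "2 * v + 1 \<in> pV (plg_mult H1 H2)" using assms by (force simp: pV_plg_mult)
  then show ?thesis using unmatched by (auto simp: plg_mult_def Let_def)
qed

lemma plab_plg_mult_outside: "w \<notin> pV (plg_mult H1 H2) \<Longrightarrow> plab (plg_mult H1 H2) w = None"
  by (simp add: plg_mult_def Let_def)

lemma labels_plg_mult:
  assumes "wf_plg H1"
  shows "labels (plg_mult H1 H2) = labels H1 \<union> labels H2"
proof -
  have "labels (plg_mult H1 H2) = {l. (\<exists>u\<in>pV H1. plab (plg_mult H1 H2) (2 * u) = Some l)
      \<or> (\<exists>v\<in>pV H2. plab (plg_mult H1 H2) (prod_map2 H1 H2 v) = Some l)}"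
    unfolding labels_def pV_plg_mult by blast
  also have "\<dots> = labels H1 \<union> labels H2"
    using assms by (auto simp: plab_plg_mult_left plab_plg_mult_right labels_def)
  finally show ?thesis .
qed

lemma wf_plg_mult:
  assumes "wf_plg H1" "wf_plg H2"
  shows "wf_plg (plg_mult H1 H2)"
proof -
  let ?H = "plg_mult H1 H2" and ?m = "prod_map2 H1 H2"
  have fin: "finite (pV ?H)" using assms by (simp add: pV_plg_mult wf_plg_def)
  have edge: "e \<subseteq> pV ?H \<and> card e = 2" if e: "e \<in> pE ?H" for e
  proof -
    consider e' where "e' \<in> pE H1" "e = (\<lambda>u. 2 * u) ` e'" | e' where "e' \<in> pE H2" "e = ?m ` e'"
      using e by (auto simp: pE_plg_mult)
    then show ?thesis
    proof cases
      case 1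
      then have e': "e' \<subseteq> pV H1" "card e' = 2" using assms by (auto simp: wf_plg_def)
      have "card e = card e'" unfolding 1 by (intro card_image) (auto simp: inj_on_def)
      then show ?thesis using 1 e' by (auto simp: pV_plg_mult)
    next
      case 2
      then have e': "e' \<subseteq> pV H2" "card e' = 2" using assms by (auto simp: wf_plg_def)
      have "card e = card e'" unfolding 2
        using inj_on_prod_map2 [OF assms] e' by (intro card_image) (auto intro: inj_on_subset)
      then show ?thesis using 2 e' by (auto simp: pV_plg_mult)
    qed
  qed
  have inj1: "u = u'" if "u \<in> pV H1" "u' \<in> pV H1" "plab H1 u = Some l" "plab H1 u' = Some l" for u u' l
    using that assms(1) by (auto simp: wf_plg_def inj_on_def)
  have inj2: "u = u'" if "u \<in> pV H2" "u' \<in> pV H2" "plab H2 u = Some l" "plab H2 u' = Some l" for u u' l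
    using that assms(2) by (auto simp: wf_plg_def inj_on_def)
  have inj: "w = w'" if w: "w \<in> pV ?H" "w' \<in> pV ?H" "plab ?H w = Some l" "plab ?H w' = Some l" for w w' l
  proof -
    \<comment> \<open>Vertices of different factors with a common label have been identified by
      \<open>prod_map2\<close>.\<close>
    have key: "x = y" if "x \<in> (\<lambda>u. 2 * u) ` pV H1" "y \<in> ?m ` pV H2" "plab ?H x = Some l" "plab ?H y = Some l" for x y
      using that assms by (auto simp: plab_plg_mult_left plab_plg_mult_right prod_map2_matched)
    have key1: "x = y" if "x \<in> (\<lambda>u. 2 * u) ` pV H1" "y \<in> (\<lambda>u. 2 * u) ` pV H1"
      "plab ?H x = Some l" "plab ?H y = Some l" for x y
      using that by (auto simp: plab_plg_mult_left dest: inj1)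
    have key2: "x = y" if "x \<in> ?m ` pV H2" "y \<in> ?m ` pV H2"
      "plab ?H x = Some l" "plab ?H y = Some l" for x y
      using that assms by (auto simp: plab_plg_mult_right dest: inj2)
    from w show ?thesis unfolding pV_plg_mult using key key1 key2 by (metis UnE)
  qed
  have pos: "l \<ge> 1" if "plab ?H w = Some l" for w l
  proof -
    have "w \<in> pV ?H" using that plab_plg_mult_outside by force
    then have "l \<in> labels ?H" using that by (auto simp: labels_def)
    then have "l \<in> labels H1 \<union> labels H2" by (simp add: labels_plg_mult [OF assms(1)])
    then show ?thesis using assms by (auto simp: labels_def wf_plg_def)
  qed
  have "inj_on (plab ?H) {v \<in> pV ?H. plab ?H v \<noteq> None}"
    by (rule inj_onI) (use inj in \<open>metis (mono_tags, lifting) mem_Collect_eq option.exhaust\<close>)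
  then show ?thesis
    unfolding wf_plg_def using fin edge pos plab_plg_mult_outside [of _ H1 H2] by blast
qed

section \<open>Closure properties of the elements of the algebra\<close>

lemma is_el_delta: "wf_plg H \<Longrightarrow> is_el (delta H)"
  by (simp add: is_el_def supp_delta)

lemma is_el_lincomb: "is_el f \<Longrightarrow> is_el g \<Longrightarrow> is_el (\<lambda>X. a * f X + b * g X)"
  unfolding is_el_def using supp_lincomb [of a f b g] by (blast intro: finite_subset)

lemma is_el_pmul:
  assumes "is_el f" "is_el g"
  shows "is_el (pmul f g)"
  unfolding is_el_def
proof (intro conjI ballI)
  show "finite (supp (pmul f g))"
    using assms by (intro finite_subset [OF supp_pmul]) (auto simp: is_el_def)
  fix H assume "H \<in> supp (pmul f g)"
  then obtain H1 H2 where "H1 \<in> supp f" "H2 \<in> supp g" "H = plg_mult H1 H2"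
    using supp_pmul by fastforce
  then show "wf_plg H" using assms wf_plg_mult by (simp add: is_el_def)
qed

lemma is_el_unlabel:
  assumes "is_el f"
  shows "is_el (unlabel T f)"
  unfolding is_el_def
proof (intro conjI ballI)
  show "finite (supp (unlabel T f))"
    using assms by (intro finite_subset [OF supp_unlabel]) (auto simp: is_el_def)
  fix H assume "H \<in> supp (unlabel T f)"
  then obtain H1 where "H1 \<in> supp f" "H = plg_unlabel T H1"
    using supp_unlabel by blast
  then show "wf_plg H" using assms wf_plg_unlabel by (simp add: is_el_def)
qed

lemma in_FL_delta: "in_FL (labels H) (delta H)"
  by (simp add: in_FL_def supp_delta)

lemma in_FL_lincomb: "in_FL L f \<Longrightarrow> in_FL L g \<Longrightarrow> in_FL L (\<lambda>X. a * f X + b * g X)"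
  unfolding in_FL_def using supp_lincomb [of a f b g] by blast

lemma in_FL_pmul:
  assumes "is_el f" "in_FL L f" "in_FL L g"
  shows "in_FL L (pmul f g)"
  unfolding in_FL_def
proof
  fix H assume "H \<in> supp (pmul f g)"
  then obtain H1 H2 where "H1 \<in> supp f" "H2 \<in> supp g" "H = plg_mult H1 H2"
    using supp_pmul by fastforce
  then show "labels H = L" using assms labels_plg_mult by (simp add: is_el_def in_FL_def)
qed

section \<open>Homomorphism densities\<close>

definition assignment :: "plg \<Rightarrow> (nat \<Rightarrow> nat) \<Rightarrow> (nat \<Rightarrow> nat) \<Rightarrow> nat \<Rightarrow> nat" where
  "assignment H \<phi> \<psi> v = (case plab H v of Some l \<Rightarrow> \<phi> l | None \<Rightarrow> \<psi> v)"

definition homs :: "plg \<Rightarrow> nat set \<Rightarrow> nat set set \<Rightarrow> (nat \<Rightarrow> nat) \<Rightarrow> (nat \<Rightarrow> nat) set" where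
  "homs H VG EG \<phi> = {\<psi> \<in> unlabeled_vertices H \<rightarrow>\<^sub>E VG. is_hom H EG (assignment H \<phi> \<psi>)}"

lemma tdens_homs:
  "tdens H VG EG \<phi> = real (card (homs H VG EG \<phi>)) / real (card VG) ^ card (unlabeled_vertices H)"
  unfolding tdens_def homs_def assignment_def ..

lemma finite_unlabeled_vertices: "wf_plg H \<Longrightarrow> finite (unlabeled_vertices H)"
  by (simp add: unlabeled_vertices_def wf_plg_def)

lemma finite_homs: "wf_plg H \<Longrightarrow> finite VG \<Longrightarrow> finite (homs H VG EG \<phi>)"
  unfolding homs_def by (intro finite_Collect_conjI disjI1) 
    (simp add: finite_PiE finite_unlabeled_vertices)

lemma is_hom_cong:
  assumes "wf_plg H" "\<And>v. v \<in> pV H \<Longrightarrow> m v = m' v"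
  shows "is_hom H EG m \<longleftrightarrow> is_hom H EG m'"
proof -
  have "m ` e = m' ` e" if "e \<in> pE H" for e
    using that assms by (intro image_cong) (auto simp: wf_plg_def)
  then show ?thesis by (simp add: is_hom_def)
qed

lemma in_labelsI: "wf_plg H \<Longrightarrow> plab H v = Some l \<Longrightarrow> l \<in> labels H"
  unfolding labels_def wf_plg_def by force

lemma tdens_cong:
  assumes "wf_plg H" "\<And>l. l \<in> labels H \<Longrightarrow> \<phi> l = \<phi>' l"
  shows "tdens H VG EG \<phi> = tdens H VG EG \<phi>'"
proof -
  have "assignment H \<phi> \<psi> = assignment H \<phi>' \<psi>" for \<psi>
    using assms in_labelsI by (auto simp: assignment_def fun_eq_iff split: option.splits)
  then show ?thesis by (simp add: tdens_homs homs_def)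
qed

text \<open>Composition with \<pi> maps homomorphisms to homomorphisms. As \<pi> is an involution,
  this map is its own inverse and one inclusion suffices.\<close>

lemma tdens_automorphism:
  assumes "wf_plg H" and \<pi>: "\<And>x. \<pi> (\<pi> x) = x" "\<pi> ` VG \<subseteq> VG" "\<And>e. e \<in> EG \<Longrightarrow> \<pi> ` e \<in> EG"
  shows "tdens H VG EG (\<lambda>l. \<pi> (\<phi> l)) = tdens H VG EG \<phi>"
proof -
  let ?U = "unlabeled_vertices H"
  let ?r = "\<lambda>\<psi>. restrict (\<lambda>v. \<pi> (\<psi> v)) ?U"
  have maps: "?r \<psi> \<in> homs H VG EG (\<lambda>l. \<pi> (\<phi> l))" if \<psi>: "\<psi> \<in> homs H VG EG \<phi>" for \<psi> \<phi>
  proof -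
    have "is_hom H EG (\<lambda>v. \<pi> (assignment H \<phi> \<psi> v))"
      using \<psi> \<pi>(3) unfolding is_hom_def homs_def by (auto simp: image_image [symmetric])
    moreover have "is_hom H EG (\<lambda>v. \<pi> (assignment H \<phi> \<psi> v))
        \<longleftrightarrow> is_hom H EG (assignment H (\<lambda>l. \<pi> (\<phi> l)) (?r \<psi>))"
      by (rule is_hom_cong [OF assms(1)])
        (auto simp: assignment_def unlabeled_vertices_def split: option.splits)
    ultimately show ?thesis using \<psi> \<pi>(2) by (auto simp: homs_def)
  qed
  have inv: "?r (?r \<psi>) = \<psi>" if "\<psi> \<in> homs H VG EG \<phi>" for \<psi> \<phi>
  proof -
    have "?r (?r \<psi>) = restrict \<psi> ?U" by (auto simp: fun_eq_iff \<pi>(1))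
    also have "\<dots> = \<psi>" using that unfolding homs_def by (blast intro: PiE_restrict)
    finally show ?thesis .
  qed
  have "bij_betw ?r (homs H VG EG \<phi>) (homs H VG EG (\<lambda>l. \<pi> (\<phi> l)))"
  proof (rule bij_betw_byWitness [where f' = ?r])
    show "?r ` homs H VG EG (\<lambda>l. \<pi> (\<phi> l)) \<subseteq> homs H VG EG \<phi>"
      using maps [of _ "\<lambda>l. \<pi> (\<phi> l)"] by (auto simp: \<pi>(1))
  qed (use maps inv in auto)
  then have "card (homs H VG EG \<phi>) = card (homs H VG EG (\<lambda>l. \<pi> (\<phi> l)))"
    by (rule bij_betw_same_card)
  then show ?thesis by (simp add: tdens_homs)
qed

text \<open>Homomorphisms are pulled back along the vertex bijection, which restricts to a bijection
  of the unlabeled vertices.\<close>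

lemma tdens_iso:
  assumes "wf_plg H" "wf_plg H'" "plg_iso H H'"
  shows "tdens H VG EG \<phi> = tdens H' VG EG \<phi>"
proof -
  obtain h where h: "bij_betw h (pV H) (pV H')" "(\<lambda>e. h ` e) ` pE H = pE H'"
    "\<And>v. v \<in> pV H \<Longrightarrow> plab H' (h v) = plab H v"
    using assms(3) unfolding plg_iso_def by (elim exE conjE) (rule that, auto)
  let ?U = "unlabeled_vertices H" and ?U' = "unlabeled_vertices H'"
  have hU: "bij_betw h ?U ?U'"
    unfolding bij_betw_def
  proof
    show "inj_on h ?U" using h(1) by (auto simp: bij_betw_def unlabeled_vertices_def inj_on_def)
    have "pV H' = h ` pV H" using h(1) by (simp add: bij_betw_def)
    then show "h ` ?U = ?U'" using h(3) by (auto simp: unlabeled_vertices_def)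
  qed
  define k where "k = inv_into ?U h"
  have k: "k v \<in> ?U" "h (k v) = v" if "v \<in> ?U'" for v
    using that hU unfolding k_def bij_betw_def by (auto intro: inv_into_into f_inv_into_f)
  have kh: "k (h v) = v" if "v \<in> ?U" for v
    using that hU unfolding k_def bij_betw_def by (simp add: inv_into_f_f)
  have hin: "h v \<in> ?U'" if "v \<in> ?U" for v using that hU by (auto simp: bij_betw_def)
  have hom: "is_hom H' EG (assignment H' \<phi> \<psi>) \<longleftrightarrow> is_hom H EG (assignment H \<phi> (restrict (\<lambda>v. \<psi> (h v)) ?U))" for \<psi>
  proof -
    have "is_hom H' EG (assignment H' \<phi> \<psi>) \<longleftrightarrow> is_hom H EG (\<lambda>v. assignment H' \<phi> \<psi> (h v))"
      unfolding is_hom_def h(2) [symmetric] by (auto simp: image_image)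
    also have "\<dots> \<longleftrightarrow> is_hom H EG (assignment H \<phi> (restrict (\<lambda>v. \<psi> (h v)) ?U))"
      by (rule is_hom_cong [OF assms(1)])
        (auto simp: assignment_def h(3) unlabeled_vertices_def split: option.splits)
    finally show ?thesis .
  qed
  have "bij_betw (\<lambda>\<psi>. restrict (\<lambda>v. \<psi> (h v)) ?U) (homs H' VG EG \<phi>) (homs H VG EG \<phi>)"
  proof (rule bij_betw_byWitness [where f' = "\<lambda>\<psi>. restrict (\<lambda>v. \<psi> (k v)) ?U'"])
    show "\<forall>\<psi>\<in>homs H' VG EG \<phi>. restrict (\<lambda>v. restrict (\<lambda>v. \<psi> (h v)) ?U (k v)) ?U' = \<psi>"
    proof
      fix \<psi> assume "\<psi> \<in> homs H' VG EG \<phi>"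
      then have "restrict \<psi> ?U' = \<psi>" unfolding homs_def by (blast intro: PiE_restrict)
      moreover have "restrict (\<lambda>v. restrict (\<lambda>v. \<psi> (h v)) ?U (k v)) ?U' = restrict \<psi> ?U'"
        by (rule restrict_ext) (simp add: k)
      ultimately show "restrict (\<lambda>v. restrict (\<lambda>v. \<psi> (h v)) ?U (k v)) ?U' = \<psi>" by simp
    qed
    show *: "\<forall>\<psi>\<in>homs H VG EG \<phi>. restrict (\<lambda>v. restrict (\<lambda>v. \<psi> (k v)) ?U' (h v)) ?U = \<psi>"
    proof
      fix \<psi> assume "\<psi> \<in> homs H VG EG \<phi>"
      then have "restrict \<psi> ?U = \<psi>" unfolding homs_def by (blast intro: PiE_restrict)
      moreover have "restrict (\<lambda>v. restrict (\<lambda>v. \<psi> (k v)) ?U' (h v)) ?U = restrict \<psi> ?U"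
        by (rule restrict_ext) (simp add: kh hin)
      ultimately show "restrict (\<lambda>v. restrict (\<lambda>v. \<psi> (k v)) ?U' (h v)) ?U = \<psi>" by simp
    qed
    show "(\<lambda>\<psi>. restrict (\<lambda>v. \<psi> (h v)) ?U) ` homs H' VG EG \<phi> \<subseteq> homs H VG EG \<phi>"
      by (auto simp: homs_def hom hin)
    show "(\<lambda>\<psi>. restrict (\<lambda>v. \<psi> (k v)) ?U') ` homs H VG EG \<phi> \<subseteq> homs H' VG EG \<phi>"
      using * by (auto simp: homs_def hom k)
  qed
  then have "card (homs H' VG EG \<phi>) = card (homs H VG EG \<phi>)" by (rule bij_betw_same_card)
  moreover have "card ?U = card ?U'" using hU by (rule bij_betw_same_card)
  ultimately show ?thesis by (simp add: tdens_homs)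
qed

section \<open>Multiplicativity and averaging of densities\<close>

lemma unlabeled_vertices_plg_mult:
  assumes "wf_plg H1"
  shows "unlabeled_vertices (plg_mult H1 H2) =
    (\<lambda>u. 2 * u) ` unlabeled_vertices H1 \<union> (\<lambda>v. 2 * v + 1) ` unlabeled_vertices H2"
proof -
  let ?H = "plg_mult H1 H2"
  have "unlabeled_vertices ?H = {w \<in> (\<lambda>u. 2 * u) ` pV H1. plab ?H w = None}
      \<union> {w \<in> prod_map2 H1 H2 ` pV H2. plab ?H w = None}"
    unfolding unlabeled_vertices_def pV_plg_mult by blast
  also have "{w \<in> (\<lambda>u. 2 * u) ` pV H1. plab ?H w = None} = (\<lambda>u. 2 * u) ` unlabeled_vertices H1"
    by (auto simp: unlabeled_vertices_def plab_plg_mult_left)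
  also have "{w \<in> prod_map2 H1 H2 ` pV H2. plab ?H w = None} = prod_map2 H1 H2 ` unlabeled_vertices H2"
    by (auto simp: unlabeled_vertices_def plab_plg_mult_right [OF assms])
  also have "\<dots> = (\<lambda>v. 2 * v + 1) ` unlabeled_vertices H2"
    by (intro image_cong refl prod_map2_unmatched) (simp add: unlabeled_vertices_def)
  finally show ?thesis .
qed

text \<open>The factors share only labeled vertices, whose images are fixed by \<phi>. A
  homomorphism of the product is thus a pair of independent homomorphisms of the factors.\<close>

lemma tdens_plg_mult:
  assumes "wf_plg H1" "wf_plg H2"
  shows "tdens (plg_mult H1 H2) VG EG \<phi> = tdens H1 VG EG \<phi> * tdens H2 VG EG \<phi>"
proof -
  let ?H = "plg_mult H1 H2"
  let ?U = "unlabeled_vertices ?H" and ?U1 = "unlabeled_vertices H1" and ?U2 = "unlabeled_vertices H2"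
  note U = unlabeled_vertices_plg_mult [OF assms(1), of H2]
  \<comment> \<open>Unlabeled vertices of the first factor are even and those of the second odd:
    \<open>?p1\<close> and \<open>?p2\<close> read off the two parts, and \<open>?j\<close>
    interleaves them.\<close>
  let ?p1 = "\<lambda>\<psi>. restrict (\<lambda>u. \<psi> (2 * u)) ?U1" and ?p2 = "\<lambda>\<psi>. restrict (\<lambda>v. \<psi> (2 * v + 1)) ?U2"
  let ?j = "\<lambda>p. restrict (\<lambda>w. if even w then fst p (w div 2) else snd p (w div 2)) ?U"
  have hom: "is_hom ?H EG (assignment ?H \<phi> \<psi>) \<longleftrightarrow>
      is_hom H1 EG (assignment H1 \<phi> (?p1 \<psi>)) \<and> is_hom H2 EG (assignment H2 \<phi> (?p2 \<psi>))" for \<psi>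
  proof -
    have "is_hom ?H EG (assignment ?H \<phi> \<psi>) \<longleftrightarrow> is_hom H1 EG (\<lambda>u. assignment ?H \<phi> \<psi> (2 * u))
        \<and> is_hom H2 EG (\<lambda>v. assignment ?H \<phi> \<psi> (prod_map2 H1 H2 v))"
      by (simp add: is_hom_def pE_plg_mult ball_Un image_image)
    also have "is_hom H1 EG (\<lambda>u. assignment ?H \<phi> \<psi> (2 * u)) \<longleftrightarrow> is_hom H1 EG (assignment H1 \<phi> (?p1 \<psi>))"
      by (rule is_hom_cong [OF assms(1)])
        (auto simp: assignment_def plab_plg_mult_left unlabeled_vertices_def split: option.splits)
    also have "is_hom H2 EG (\<lambda>v. assignment ?H \<phi> \<psi> (prod_map2 H1 H2 v))
        \<longleftrightarrow> is_hom H2 EG (assignment H2 \<phi> (?p2 \<psi>))"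
    proof (rule is_hom_cong [OF assms(2)])
      fix v assume v: "v \<in> pV H2"
      show "assignment ?H \<phi> \<psi> (prod_map2 H1 H2 v) = assignment H2 \<phi> (?p2 \<psi>) v"
      proof (cases "plab H2 v")
        case None
        then have "prod_map2 H1 H2 v = 2 * v + 1" by (intro prod_map2_unmatched) simp
        then show ?thesis using plab_plg_mult_right [OF assms(1) v] None v
          by (simp add: assignment_def unlabeled_vertices_def)
      next
        case (Some l)
        then show ?thesis using plab_plg_mult_right [OF assms(1) v] by (simp add: assignment_def)
      qed
    qed
    finally show ?thesis .
  qed
  have pj: "?p1 (?j p) = fst p" "?p2 (?j p) = snd p"
    if "p \<in> (?U1 \<rightarrow>\<^sub>E VG) \<times> (?U2 \<rightarrow>\<^sub>E VG)" for p
  proof -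
    have "?p1 (?j p) = restrict (fst p) ?U1" by (rule restrict_ext) (simp add: U)
    also have "\<dots> = fst p" using that by (auto intro: PiE_restrict)
    finally show "?p1 (?j p) = fst p" .
    have "?p2 (?j p) = restrict (snd p) ?U2" by (rule restrict_ext) (simp add: U)
    also have "\<dots> = snd p" using that by (auto intro: PiE_restrict)
    finally show "?p2 (?j p) = snd p" .
  qed
  have jp: "?j (?p1 \<psi>, ?p2 \<psi>) = \<psi>" if "\<psi> \<in> ?U \<rightarrow>\<^sub>E VG" for \<psi>
  proof
    fix w
    show "?j (?p1 \<psi>, ?p2 \<psi>) w = \<psi> w"
      using PiE_arb [OF that, of w] by (cases "w \<in> ?U") (auto simp: U)
  qed
  have "bij_betw ?j (homs H1 VG EG \<phi> \<times> homs H2 VG EG \<phi>) (homs ?H VG EG \<phi>)"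
  proof (rule bij_betw_byWitness [where f' = "\<lambda>\<psi>. (?p1 \<psi>, ?p2 \<psi>)"])
    show "\<forall>p\<in>homs H1 VG EG \<phi> \<times> homs H2 VG EG \<phi>. (?p1 (?j p), ?p2 (?j p)) = p"
    proof
      fix p assume "p \<in> homs H1 VG EG \<phi> \<times> homs H2 VG EG \<phi>"
      then have "p \<in> (?U1 \<rightarrow>\<^sub>E VG) \<times> (?U2 \<rightarrow>\<^sub>E VG)" by (auto simp: homs_def)
      then show "(?p1 (?j p), ?p2 (?j p)) = p" by (simp only: pj prod.collapse)
    qed
    show "\<forall>\<psi>\<in>homs ?H VG EG \<phi>. ?j (?p1 \<psi>, ?p2 \<psi>) = \<psi>"
      using jp by (simp only: homs_def mem_Collect_eq) blast
    show "?j ` (homs H1 VG EG \<phi> \<times> homs H2 VG EG \<phi>) \<subseteq> homs ?H VG EG \<phi>"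
    proof (rule image_subsetI)
      fix p assume p: "p \<in> homs H1 VG EG \<phi> \<times> homs H2 VG EG \<phi>"
      then have p': "p \<in> (?U1 \<rightarrow>\<^sub>E VG) \<times> (?U2 \<rightarrow>\<^sub>E VG)" by (auto simp: homs_def)
      have "?j p \<in> ?U \<rightarrow>\<^sub>E VG" using p' by (auto simp: U)
      moreover have "is_hom ?H EG (assignment ?H \<phi> (?j p))"
        unfolding hom pj [OF p'] using p by (auto simp: homs_def)
      ultimately show "?j p \<in> homs ?H VG EG \<phi>" by (simp add: homs_def)
    qed
    show "(\<lambda>\<psi>. (?p1 \<psi>, ?p2 \<psi>)) ` homs ?H VG EG \<phi> \<subseteq> homs H1 VG EG \<phi> \<times> homs H2 VG EG \<phi>"
      by (auto simp: homs_def hom U PiE_iff)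
  qed
  then have "card (homs ?H VG EG \<phi>) = card (homs H1 VG EG \<phi>) * card (homs H2 VG EG \<phi>)"
    by (simp add: bij_betw_same_card [symmetric] card_cartesian_product)
  moreover have "card ?U = card ?U1 + card ?U2"
  proof -
    have "card ?U = card ((\<lambda>u. 2 * u) ` ?U1) + card ((\<lambda>v. 2 * v + 1) ` ?U2)"
      unfolding U using assms by (intro card_Un_disjoint) (auto simp: finite_unlabeled_vertices dest: arg_cong [where f = even])
    also have "card ((\<lambda>u. 2 * u) ` ?U1) = card ?U1" by (intro card_image) (auto simp: inj_on_def)
    also have "card ((\<lambda>v. 2 * v + 1) ` ?U2) = card ?U2" by (intro card_image) (auto simp: inj_on_def)
    finally show ?thesis .
  qed
  ultimately show ?thesis by (simp add: tdens_homs power_add)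
qed

lemma plg_unlabel_absent: "wf_plg H \<Longrightarrow> l \<notin> labels H \<Longrightarrow> plg_unlabel (- {l}) H = H"
  using in_labelsI [of H]
  by (cases H) (fastforce simp: plg_unlabel_def fun_eq_iff split: option.splits)

text \<open>A homomorphism of the unlabeled graph is an image \<open>x\<close> of the freed vertex
  together with a homomorphism in which the label \<open>l\<close> is sent to \<open>x\<close>. If
  \<open>l\<close> does not occur, a constant is averaged.\<close>

lemma tdens_unlabel:
  assumes "wf_plg H" "finite VG" "VG \<noteq> {}"
  shows "tdens (plg_unlabel (- {l}) H) VG EG \<phi> = (\<Sum>x\<in>VG. tdens H VG EG (\<phi>(l := x))) / card VG"
proof (cases "l \<in> labels H")
  case False
  have "tdens H VG EG (\<phi>(l := x)) = tdens H VG EG \<phi>" for x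
    using False by (intro tdens_cong [OF assms(1)]) auto
  then show ?thesis using assms by (simp add: plg_unlabel_absent False)
next
  case True
  then obtain v where v: "v \<in> pV H" "plab H v = Some l" by (auto simp: labels_def)
  have uniq: "w = v" if "plab H w = Some l" for w
  proof -
    have "w \<in> pV H" using that assms(1) by (force simp: wf_plg_def)
    then show ?thesis using that v assms(1) by (auto simp: wf_plg_def inj_on_def)
  qed
  let ?H = "plg_unlabel (- {l}) H"
  let ?U = "unlabeled_vertices H"
  have U: "unlabeled_vertices ?H = insert v ?U"
  proof -
    have "plab ?H w = None \<longleftrightarrow> w = v \<or> plab H w = None" for w
      using v by (cases "plab H w") (auto simp: plg_unlabel_def dest: uniq)
    then show ?thesis using v by (auto simp: unlabeled_vertices_def plg_unlabel_def)
  qed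
  have vU: "v \<notin> ?U" using v by (simp add: unlabeled_vertices_def)
  have asg: "assignment ?H \<phi> \<psi> = assignment H (\<phi>(l := \<psi> v)) (restrict \<psi> ?U)" 
    if "\<psi> \<in> insert v ?U \<rightarrow>\<^sub>E VG" for \<psi>
  proof
    fix w
    have arb: "\<psi> w = undefined" if "w \<notin> insert v ?U" using \<open>\<psi> \<in> _\<close> that by (rule PiE_arb)
    show "assignment ?H \<phi> \<psi> w = assignment H (\<phi>(l := \<psi> v)) (restrict \<psi> ?U) w"
    proof (cases "plab H w")
      case None
      then have "w \<noteq> v" using v by auto
      then show ?thesis using None arb by (auto simp: assignment_def plg_unlabel_def restrict_def)
    next
      case (Some l')
      then show ?thesis by (auto simp: assignment_def plg_unlabel_def dest: uniq)
    qed
  qed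
  have isH: "is_hom ?H = is_hom H" by (auto simp: is_hom_def plg_unlabel_def fun_eq_iff)
  let ?S = "Sigma VG (\<lambda>x. homs H VG EG (\<phi>(l := x)))"
  have "bij_betw (\<lambda>\<psi>. (\<psi> v, restrict \<psi> ?U)) (homs ?H VG EG \<phi>) ?S"
  proof (rule bij_betw_byWitness [where f' = "\<lambda>p. (snd p)(v := fst p)"])
    show "\<forall>\<psi>\<in>homs ?H VG EG \<phi>. (snd (\<psi> v, restrict \<psi> ?U))(v := fst (\<psi> v, restrict \<psi> ?U)) = \<psi>"
    proof
      fix \<psi> assume "\<psi> \<in> homs ?H VG EG \<phi>"
      then have "\<psi> \<in> insert v ?U \<rightarrow>\<^sub>E VG" by (simp add: homs_def U)
      then have "\<psi> w = undefined" if "w \<notin> insert v ?U" for w using that by (rule PiE_arb)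
      then show "(snd (\<psi> v, restrict \<psi> ?U))(v := fst (\<psi> v, restrict \<psi> ?U)) = \<psi>"
        by (auto simp: fun_eq_iff restrict_def)
    qed
    have res: "restrict (\<psi>(v := x)) ?U = \<psi>" if "\<psi> \<in> ?U \<rightarrow>\<^sub>E VG" for \<psi> x
      using PiE_arb [OF that] vU by (auto simp: fun_eq_iff restrict_def)
    then show "\<forall>p\<in>?S. (((snd p)(v := fst p)) v, restrict ((snd p)(v := fst p)) ?U) = p"
      by (auto simp: homs_def)
    show "(\<lambda>\<psi>. (\<psi> v, restrict \<psi> ?U)) ` homs ?H VG EG \<phi> \<subseteq> ?S"
    proof (rule image_subsetI)
      fix \<psi> assume "\<psi> \<in> homs ?H VG EG \<phi>"
      then have \<psi>: "\<psi> \<in> insert v ?U \<rightarrow>\<^sub>E VG" "is_hom H EG (assignment ?H \<phi> \<psi>)"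
        by (simp_all add: homs_def U isH)
      then have "is_hom H EG (assignment H (\<phi>(l := \<psi> v)) (restrict \<psi> ?U))"
        by (simp only: asg)
      moreover have "restrict \<psi> ?U \<in> ?U \<rightarrow>\<^sub>E VG" using \<psi> by (auto simp: PiE_iff)
      moreover have "\<psi> v \<in> VG" using \<psi> by auto
      ultimately show "(\<psi> v, restrict \<psi> ?U) \<in> ?S" by (simp add: homs_def)
    qed
    show "(\<lambda>p. (snd p)(v := fst p)) ` ?S \<subseteq> homs ?H VG EG \<phi>"
    proof (rule image_subsetI)
      fix p assume p: "p \<in> ?S"
      then have p': "snd p \<in> ?U \<rightarrow>\<^sub>E VG" "fst p \<in> VG"
        "is_hom H EG (assignment H (\<phi>(l := fst p)) (snd p))" by (auto simp: homs_def)
      then have mem: "(snd p)(v := fst p) \<in> insert v ?U \<rightarrow>\<^sub>E VG" by (auto simp: PiE_iff extensional_def)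
      have "assignment ?H \<phi> ((snd p)(v := fst p)) = assignment H (\<phi>(l := fst p)) (snd p)"
        using asg [OF mem] res [OF p'(1)] by simp
      then show "(snd p)(v := fst p) \<in> homs ?H VG EG \<phi>"
        using mem p' by (simp add: homs_def U isH)
    qed
  qed
  then have "card (homs ?H VG EG \<phi>) = card ?S" by (rule bij_betw_same_card)
  also have "\<dots> = (\<Sum>x\<in>VG. card (homs H VG EG (\<phi>(l := x))))"
    using assms by (intro card_SigmaI) (auto simp: finite_homs)
  finally have c: "card (homs ?H VG EG \<phi>) = \<dots>" .
  have "card (insert v ?U) = Suc (card ?U)"
    using vU assms by (simp add: finite_unlabeled_vertices)
  then show ?thesis using c by (simp add: tdens_homs U sum_divide_distrib mult.commute)
qed

lemma tdens_empty_plg: "tdens empty_plg VG EG \<phi> = 1"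
proof -
  have "homs empty_plg VG EG \<phi> = {\<lambda>_. undefined}"
    by (auto simp: homs_def empty_plg_def unlabeled_vertices_def is_hom_def)
  then show ?thesis by (simp add: tdens_homs unlabeled_vertices_def empty_plg_def)
qed

lemma tdens_one_vertex:
  assumes "wf_plg F" "card (pV F) = 1" "finite VG" "VG \<noteq> {}"
  shows "tdens F VG EG \<phi> = 1"
proof -
  obtain v where v: "pV F = {v}" using assms(2) card_1_singletonE by blast
  have "e \<notin> pE F" for e
  proof
    assume "e \<in> pE F"
    then have "e \<subseteq> {v}" "card e = 2" using assms(1) v by (auto simp: wf_plg_def)
    then show False using card_mono [of "{v}" e] by simp
  qed
  then have "is_hom F EG m" for m by (auto simp: is_hom_def)
  then have "homs F VG EG \<phi> = unlabeled_vertices F \<rightarrow>\<^sub>E VG" by (simp add: homs_def)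
  then show ?thesis using assms
    by (simp add: tdens_homs card_PiE finite_unlabeled_vertices)
qed

section \<open>A model with a real number of vertices\<close>

definition rat_fun :: "(real \<Rightarrow> real) \<Rightarrow> bool" where
  "rat_fun F \<longleftrightarrow> (\<exists>p k. \<forall>N>0. F N = poly p N / N ^ k)"

lemma rat_fun_const: "rat_fun (\<lambda>_. c)"
  unfolding rat_fun_def by (rule exI [of _ "[:c:]"], rule exI [of _ 0]) simp

lemma rat_fun_diff_const: "rat_fun (\<lambda>N. N - c)"
  unfolding rat_fun_def by (rule exI [of _ "[:- c, 1:]"], rule exI [of _ 0]) simp

lemma rat_fun_mult:
  assumes "rat_fun F" "rat_fun G"
  shows "rat_fun (\<lambda>N. F N * G N)"
proof -
  obtain p k q l where "\<And>N. N > 0 \<Longrightarrow> F N = poly p N / N ^ k" "\<And>N. N > 0 \<Longrightarrow> G N = poly q N / N ^ l"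
    using assms unfolding rat_fun_def by metis
  then have "\<forall>N>0. F N * G N = poly (p * q) N / N ^ (k + l)" by (simp add: power_add)
  then show ?thesis unfolding rat_fun_def by blast
qed

lemma rat_fun_add:
  assumes "rat_fun F" "rat_fun G"
  shows "rat_fun (\<lambda>N. F N + G N)"
proof -
  obtain p k q l where "\<And>N. N > 0 \<Longrightarrow> F N = poly p N / N ^ k" "\<And>N. N > 0 \<Longrightarrow> G N = poly q N / N ^ l"
    using assms unfolding rat_fun_def by metis
  then have "\<forall>N>0. F N + G N = poly (p * monom 1 l + q * monom 1 k) N / N ^ (k + l)"
    by (simp add: power_add poly_monom field_simps)
  then show ?thesis unfolding rat_fun_def by blast
qed

lemma rat_fun_divide_arg:
  assumes "rat_fun F"
  shows "rat_fun (\<lambda>N. F N / N)"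
proof -
  obtain p k where "\<And>N. N > 0 \<Longrightarrow> F N = poly p N / N ^ k"
    using assms unfolding rat_fun_def by metis
  then have "\<forall>N>0. F N / N = poly p N / N ^ Suc k" by simp
  then show ?thesis unfolding rat_fun_def by blast
qed

lemma rat_fun_sum: "(\<And>x. x \<in> A \<Longrightarrow> rat_fun (F x)) \<Longrightarrow> rat_fun (\<lambda>N. \<Sum>x\<in>A. F x N)"
  by (induction A rule: infinite_finite_induct) (auto intro: rat_fun_const rat_fun_add)

text \<open>After clearing the powers of \<open>N\<close>, the difference is a polynomial with
  infinitely many integer roots, so it vanishes identically. This makes interpolation to real
  \<open>N\<close> unique.\<close>

lemma rat_fun_eqI:
  assumes "rat_fun F" "rat_fun G" "\<forall>\<^sub>F M in sequentially. F (real M) = G (real M)" "N > 0"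
  shows "F N = G N"
proof -
  obtain p k q l where F: "\<And>N. N > 0 \<Longrightarrow> F N = poly p N / N ^ k"
    and G: "\<And>N. N > 0 \<Longrightarrow> G N = poly q N / N ^ l"
    using assms(1,2) unfolding rat_fun_def by metis
  let ?d = "p * monom 1 l - q * monom 1 k"
  obtain M0 where M0: "\<And>M. M \<ge> M0 \<Longrightarrow> F (real M) = G (real M)"
    using assms(3) unfolding eventually_sequentially by blast
  have "real ` {M0<..} \<subseteq> {x. poly ?d x = 0}"
  proof
    fix x assume "x \<in> real ` {M0<..}"
    then obtain M where M: "M > M0" "x = real M" by auto
    then have "poly p x / x ^ k = poly q x / x ^ l" using M0 [of M] F [of x] G [of x] by simp
    then show "x \<in> {x. poly ?d x = 0}" using M by (simp add: poly_monom field_simps)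
  qed
  moreover have "infinite (real ` {M0<..})"
    by (subst finite_image_iff) (auto simp: inj_on_def infinite_Ioi)
  ultimately have "infinite {x. poly ?d x = 0}" using finite_subset by blast
  then have "?d = 0" using poly_roots_finite by blast
  then have "poly ?d N = 0" by simp
  then have "poly p N / N ^ k = poly q N / N ^ l" using assms(4) by (simp add: poly_monom frac_eq_eq)
  then show ?thesis by (simp add: F G assms(4))
qed

section \<open>Disjoint edges and isolated loops\<close>

definition partner :: "nat \<Rightarrow> nat \<Rightarrow> nat" where
  "partner n x = (if x < 2 * n then (if even x then x + 1 else x - 1) else x)"

text \<open>The target of the homomorphism counts may have loops: a singleton \<open>{x}\<close> in the edge set is a
  loop at \<open>x\<close>.  The points below \<open>2 * n\<close> form \<open>n\<close> disjoint edges, all others carry loops.\<close>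

definition model_edges :: "nat \<Rightarrow> nat set set" where
  "model_edges n = range (\<lambda>x. {x, partner n x})"

lemma partner_less_iff: "partner n x < 2 * n \<longleftrightarrow> x < 2 * n"
  unfolding partner_def by (auto elim!: evenE oddE)

text \<open>Transposing two loops that carry no label is an automorphism of the model.\<close>

lemma tdens_fresh:
  assumes "wf_plg H" "{..<2 * n} \<union> \<phi> ` (labels H - {l}) \<subseteq> J" "y \<notin> J" "z \<notin> J" "y < M" "z < M"
  shows "tdens H {..<M} (model_edges n) (\<phi>(l := y)) = tdens H {..<M} (model_edges n) (\<phi>(l := z))"
proof -
  define \<pi> where "\<pi> = (\<lambda>x. if x = y then z else if x = z then y else x)"
  have yz: "y \<ge> 2 * n" "z \<ge> 2 * n" using assms by (auto simp: not_less [symmetric])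
  have "tdens H {..<M} (model_edges n) (\<phi>(l := z)) = tdens H {..<M} (model_edges n) (\<lambda>k. \<pi> ((\<phi>(l := y)) k))"
    using assms by (intro tdens_cong) (auto simp: \<pi>_def)
  also have "\<dots> = tdens H {..<M} (model_edges n) (\<phi>(l := y))"
  proof (rule tdens_automorphism [OF assms(1)])
    show "\<pi> (\<pi> x) = x" for x by (simp add: \<pi>_def)
    show "\<pi> ` {..<M} \<subseteq> {..<M}" using assms by (auto simp: \<pi>_def)
    fix e assume "e \<in> model_edges n"
    then obtain x where e: "e = {x, partner n x}" by (auto simp: model_edges_def)
    have "\<pi> (partner n x) = partner n (\<pi> x)"
    proof (cases "x < 2 * n")
      case True
      then have "partner n x < 2 * n" by (simp add: partner_less_iff)
      then show ?thesis using True yz by (auto simp: \<pi>_def)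
    next
      case False
      then show ?thesis using yz by (auto simp: \<pi>_def partner_def)
    qed
    then show "\<pi> ` e \<in> model_edges n" by (auto simp: e model_edges_def)
  qed
  finally show ?thesis ..
qed

text \<open>In the average over the image of \<open>l\<close>, all points outside \<open>J\<close>
  are loops without a label and contribute equally, so one fresh point \<open>y\<close> represents
  them. Neither \<open>J\<close> nor \<open>y\<close> depends on \<open>M\<close>, which only has to
  be large enough to contain them.\<close>

lemma tdens_unlabel_model:
  assumes "wf_plg H" "finite J" "{..<2 * n} \<union> \<phi> ` (labels H - {l}) \<subseteq> J" "y \<notin> J"
  shows "\<forall>\<^sub>F M in sequentially. tdens (plg_unlabel (- {l}) H) {..<M} (model_edges n) \<phi> =
    ((\<Sum>x\<in>J. tdens H {..<M} (model_edges n) (\<phi>(l := x)))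
      + (real M - card J) * tdens H {..<M} (model_edges n) (\<phi>(l := y))) / real M"
proof -
  have "\<forall>\<^sub>F M in sequentially. Max (insert y J) < M" by (rule eventually_gt_at_top)
  then show ?thesis
  proof eventually_elim
    case (elim M)
    then have M: "y < M" "J \<subseteq> {..<M}" using assms(2) by auto
    let ?t = "\<lambda>x. tdens H {..<M} (model_edges n) (\<phi>(l := x))"
    have "(\<Sum>x\<in>{..<M}. ?t x) = (\<Sum>x\<in>{..<M} - J. ?t x) + (\<Sum>x\<in>J. ?t x)"
      using M by (intro sum.subset_diff) auto
    also have "(\<Sum>x\<in>{..<M} - J. ?t x) = (\<Sum>x\<in>{..<M} - J. ?t y)"
      using assms M by (intro sum.cong refl tdens_fresh) auto
    also have "\<dots> = (real M - card J) * ?t y"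
    proof -
      have "card ({..<M} - J) = M - card J" using M assms(2) by (simp add: card_Diff_subset)
      moreover have "card J \<le> M" using card_mono [OF _ M(2)] by simp
      ultimately show ?thesis by (simp add: of_nat_diff)
    qed
    finally have sum: "(\<Sum>x\<in>{..<M}. ?t x) = (\<Sum>x\<in>J. ?t x) + (real M - card J) * ?t y"
      by (simp only: add.commute)
    have "{..<M} \<noteq> {}" using M by auto
    then have "tdens (plg_unlabel (- {l}) H) {..<M} (model_edges n) \<phi> = (\<Sum>x\<in>{..<M}. ?t x) / card {..<M}"
      by (intro tdens_unlabel assms) auto
    then show ?case unfolding sum card_lessThan .
  qed
qed

text \<open>Induction on the number of unlabeled vertices: one of them receives a new label and is
  averaged out again. The sum runs over a set independent of \<open>M\<close>, so \<open>M\<close>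
  enters only through the weights and the densities of the smaller case.\<close>

lemma tdens_model_rational:
  assumes "wf_plg H"
  shows "\<exists>F. rat_fun F \<and> (\<forall>\<^sub>F M in sequentially. F (real M) = tdens H {..<M} (model_edges n) \<phi>)"
  using assms
proof (induction "card (unlabeled_vertices H)" arbitrary: H \<phi>)
  case 0
  then have "unlabeled_vertices H = {}" by (simp add: finite_unlabeled_vertices)
  \<comment> \<open>With no vertex left to place, the vertex set of the target does not
    enter.\<close>
  then have "tdens H {..<M} (model_edges n) \<phi> = tdens H {} (model_edges n) \<phi>" for M
    by (simp add: tdens_homs homs_def)
  then have "\<forall>\<^sub>F M in sequentially. tdens H {} (model_edges n) \<phi> = tdens H {..<M} (model_edges n) \<phi>"
    by simp
  then show ?case using rat_fun_const by fast
next
  case (Suc c)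
  then obtain v where v: "v \<in> unlabeled_vertices H" by fastforce
  then have v': "v \<in> pV H" "plab H v = None" by (auto simp: unlabeled_vertices_def)
  \<comment> \<open>Labels are positive, so \<open>0\<close> is excluded as well.\<close>
  obtain l where l: "l \<notin> insert 0 (labels H)"
    using finite_labels [OF Suc.prems] ex_new_if_finite [of "insert 0 (labels H)"] by auto
  define H' where "H' = H\<lparr>plab := (plab H)(v := Some l)\<rparr>"
  have H': "pV H' = pV H" "pE H' = pE H" "plab H' = (plab H)(v := Some l)" by (simp_all add: H'_def)
  have nl: "plab H w \<noteq> Some l" for w using l in_labelsI [OF Suc.prems, of w l] by auto
  have wf: "wf_plg H'"
  proof -
    have inj: "inj_on (plab H) {w \<in> pV H. plab H w \<noteq> None}" and "l \<ge> 1"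
      using Suc.prems l by (auto simp: wf_plg_def)
    have "inj_on (plab H') {w \<in> pV H'. plab H' w \<noteq> None}"
      unfolding H'
    proof (rule inj_onI)
      fix a b
      assume "a \<in> {w \<in> pV H. ((plab H)(v := Some l)) w \<noteq> None}"
        "b \<in> {w \<in> pV H. ((plab H)(v := Some l)) w \<noteq> None}"
        "((plab H)(v := Some l)) a = ((plab H)(v := Some l)) b"
      then show "a = b"
        using inj_onD [OF inj, of a b] nl [of a] nl [of b] by (cases "a = v"; cases "b = v") auto
    qed
    then show ?thesis
      using Suc.prems v' \<open>l \<ge> 1\<close> unfolding wf_plg_def H' by auto
  qed
  have labels: "labels H' = insert l (labels H)"
  proof -
    have "(\<exists>w\<in>pV H. ((plab H)(v := Some l)) w = Some k) \<longleftrightarrow> k = l \<or> (\<exists>w\<in>pV H. plab H w = Some k)" for k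
    proof (cases "k = l")
      case False
      then have "((plab H)(v := Some l)) w = Some k \<longleftrightarrow> plab H w = Some k" for w using v' by auto
      then show ?thesis using False by simp
    qed (use v' in auto)
    then show ?thesis by (auto simp: labels_def H')
  qed
  have H: "plg_unlabel (- {l}) H' = H"
    using nl v' by (cases H) (auto simp: plg_unlabel_def H'_def fun_eq_iff split: option.splits)
  have "unlabeled_vertices H' = unlabeled_vertices H - {v}" by (auto simp: unlabeled_vertices_def H')
  then have "c = card (unlabeled_vertices H')"
    using Suc(2) v by (simp add: finite_unlabeled_vertices Suc.prems)
  note IH = Suc(1) [OF this wf]
  define J where "J = {..<2 * n} \<union> \<phi> ` labels H"
  have J: "finite J" "{..<2 * n} \<union> \<phi> ` (labels H' - {l}) \<subseteq> J"
    using finite_labels [OF Suc.prems] by (auto simp: J_def labels)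
  obtain y where y: "y \<notin> J" using J(1) ex_new_if_finite by blast
  have "\<forall>x. \<exists>F. rat_fun F \<and>
      (\<forall>\<^sub>F M in sequentially. F (real M) = tdens H' {..<M} (model_edges n) (\<phi>(l := x)))"
    by (intro allI IH)
  from choice [OF this] obtain F where F: "\<And>x. rat_fun (F x)"
    "\<And>x. \<forall>\<^sub>F M in sequentially. F x (real M) = tdens H' {..<M} (model_edges n) (\<phi>(l := x))"
    by blast
  define G where "G = (\<lambda>N. ((\<Sum>x\<in>J. F x N) + (N - card J) * F y N) / N)"
  have "rat_fun G" unfolding G_def
    by (intro rat_fun_divide_arg rat_fun_add rat_fun_mult rat_fun_sum rat_fun_diff_const F)
  moreover have "\<forall>\<^sub>F M in sequentially. G (real M) = tdens H {..<M} (model_edges n) \<phi>"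
  proof -
    have "\<forall>\<^sub>F M in sequentially. \<forall>x\<in>insert y J. F x (real M) = tdens H' {..<M} (model_edges n) (\<phi>(l := x))"
      using J(1) by (intro eventually_ball_finite ballI F(2)) simp
    with tdens_unlabel_model [OF wf J y] show ?thesis
    proof eventually_elim
      case (elim M)
      then show ?case by (simp add: G_def H)
    qed
  qed
  ultimately show ?case by blast
qed

text \<open>\<open>ev n H \<phi> N\<close> is the density of \<open>H\<close> in the model with \<open>N\<close> vertices, interpolated to real \<open>N\<close>.\<close>

definition ev :: "nat \<Rightarrow> plg \<Rightarrow> (nat \<Rightarrow> nat) \<Rightarrow> real \<Rightarrow> real" where
  "ev n H \<phi> = (SOME F. rat_fun F \<and>
     (\<forall>\<^sub>F M in sequentially. F (real M) = tdens H {..<M} (model_edges n) \<phi>))"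

lemma
  assumes "wf_plg H"
  shows rat_fun_ev: "rat_fun (ev n H \<phi>)"
    and ev_of_nat: "\<forall>\<^sub>F M in sequentially. ev n H \<phi> (real M) = tdens H {..<M} (model_edges n) \<phi>"
  using someI_ex [OF tdens_model_rational [OF assms, of n \<phi>]] unfolding ev_def by blast+

text \<open>The interpolating function is unique, so identities between densities at large integer
  sizes carry over to every real \<open>N > 0\<close>.\<close>

lemma ev_eqI:
  assumes "wf_plg H" "rat_fun F"
    "\<forall>\<^sub>F M in sequentially. tdens H {..<M} (model_edges n) \<phi> = F (real M)" "N > 0"
  shows "ev n H \<phi> N = F N"
proof (rule rat_fun_eqI [OF rat_fun_ev [OF assms(1)] assms(2) _ assms(4)])
  show "\<forall>\<^sub>F M in sequentially. ev n H \<phi> (real M) = F (real M)"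
    using ev_of_nat [OF assms(1), of n \<phi>] assms(3) by eventually_elim simp
qed

lemma ev_iso:
  assumes "wf_plg H" "wf_plg H'" "plg_iso H H'" "N > 0"
  shows "ev n H \<phi> N = ev n H' \<phi> N"
proof (rule ev_eqI [OF assms(1) rat_fun_ev [OF assms(2)] _ assms(4)])
  show "\<forall>\<^sub>F M in sequentially. tdens H {..<M} (model_edges n) \<phi> = ev n H' \<phi> (real M)"
    using ev_of_nat [OF assms(2), of n \<phi>]
    by eventually_elim (simp add: tdens_iso [OF assms(1-3)])
qed

lemma ev_plg_mult:
  assumes "wf_plg H" "wf_plg H'" "N > 0"
  shows "ev n (plg_mult H H') \<phi> N = ev n H \<phi> N * ev n H' \<phi> N"
proof (rule ev_eqI [OF wf_plg_mult [OF assms(1,2)] _ _ assms(3)])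
  show "rat_fun (\<lambda>N. ev n H \<phi> N * ev n H' \<phi> N)"
    using assms by (intro rat_fun_mult rat_fun_ev)
  show "\<forall>\<^sub>F M in sequentially. tdens (plg_mult H H') {..<M} (model_edges n) \<phi>
      = ev n H \<phi> (real M) * ev n H' \<phi> (real M)"
    using ev_of_nat [OF assms(1), of n \<phi>] ev_of_nat [OF assms(2), of n \<phi>]
    by eventually_elim (simp add: tdens_plg_mult assms)
qed

lemma wf_empty_plg: "wf_plg empty_plg"
  by (simp add: wf_plg_def empty_plg_def)

lemma ev_empty_plg: "N > 0 \<Longrightarrow> ev n empty_plg \<phi> N = 1"
  by (rule ev_eqI [OF wf_empty_plg rat_fun_const]) (simp_all add: tdens_empty_plg)

lemma ev_one_vertex:
  assumes "wf_plg F" "card (pV F) = 1" "N > 0"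
  shows "ev n F \<phi> N = 1"
proof (rule ev_eqI [OF assms(1) rat_fun_const _ assms(3)])
  show "\<forall>\<^sub>F M in sequentially. tdens F {..<M} (model_edges n) \<phi> = 1"
    using eventually_gt_at_top [of 0]
    by eventually_elim (intro tdens_one_vertex assms, auto)
qed

text \<open>Both sides are rational in \<open>N\<close>, so the averaging formula survives
  interpolation. The fresh loop now has the real weight \<open>N - card J\<close>, which can have
  either sign.\<close>

lemma ev_unlabel:
  assumes "wf_plg H" "finite J" "{..<2 * n} \<union> \<phi> ` (labels H - {l}) \<subseteq> J" "y \<notin> J" "N > 0"
  shows "ev n (plg_unlabel (- {l}) H) \<phi> N =
    ((\<Sum>x\<in>J. ev n H (\<phi>(l := x)) N) + (N - card J) * ev n H (\<phi>(l := y)) N) / N"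
proof (rule ev_eqI [OF wf_plg_unlabel [OF assms(1)] _ _ assms(5)])
  show "rat_fun (\<lambda>N. ((\<Sum>x\<in>J. ev n H (\<phi>(l := x)) N) + (N - card J) * ev n H (\<phi>(l := y)) N) / N)"
    using assms(1) by (intro rat_fun_divide_arg rat_fun_add rat_fun_mult rat_fun_sum rat_fun_diff_const rat_fun_ev)
  have "\<forall>\<^sub>F M in sequentially. \<forall>x\<in>insert y J.
      ev n H (\<phi>(l := x)) (real M) = tdens H {..<M} (model_edges n) (\<phi>(l := x))"
    using assms(1,2) by (intro eventually_ball_finite ballI ev_of_nat) auto
  with tdens_unlabel_model [OF assms(1-4)]
  show "\<forall>\<^sub>F M in sequentially. tdens (plg_unlabel (- {l}) H) {..<M} (model_edges n) \<phi> =
      ((\<Sum>x\<in>J. ev n H (\<phi>(l := x)) (real M)) + (real M - card J) * ev n H (\<phi>(l := y)) (real M)) / real M"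
    by eventually_elim simp
qed

section \<open>Soundness of the calculus in the model\<close>

definition pos_functional :: "(('a \<Rightarrow> real) \<Rightarrow> real) \<Rightarrow> bool" where
  "pos_functional \<Lambda> \<longleftrightarrow> (\<forall>F G. \<Lambda> (\<lambda>x. F x + G x) = \<Lambda> F + \<Lambda> G)
     \<and> (\<forall>c F. \<Lambda> (\<lambda>x. c * F x) = c * \<Lambda> F) \<and> (\<forall>F. (\<forall>x. F x \<ge> 0) \<longrightarrow> \<Lambda> F \<ge> 0)"

lemma pos_functional_sum:
  assumes "pos_functional \<Lambda>"
  shows "\<Lambda> (\<lambda>x. \<Sum>i\<in>A. F i x) = (\<Sum>i\<in>A. \<Lambda> (F i))"
proof (induction A rule: infinite_finite_induct)
  have scale: "\<Lambda> (\<lambda>x. c * F x) = c * \<Lambda> F" for c F using assms by (simp add: pos_functional_def)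
  from scale [of 0 "\<lambda>_. 0"] have "\<Lambda> (\<lambda>x. 0) = 0" by simp
  then show "\<Lambda> (\<lambda>x. \<Sum>i\<in>{}. F i x) = (\<Sum>i\<in>{}. \<Lambda> (F i))"
    "\<And>A. infinite A \<Longrightarrow> \<Lambda> (\<lambda>x. \<Sum>i\<in>A. F i x) = (\<Sum>i\<in>A. \<Lambda> (F i))" by simp_all
qed (use assms in \<open>simp add: pos_functional_def\<close>)

text \<open>The value at the square of \<open>s * F + t * G\<close> is a nonnegative quadratic form
  in \<open>s\<close> and \<open>t\<close>, which bounds its discriminant.\<close>

lemma pos_functional_Cauchy_Schwarz:
  assumes "pos_functional \<Lambda>"
  shows "(\<Lambda> (\<lambda>x. F x * G x))\<^sup>2 \<le> \<Lambda> (\<lambda>x. F x * F x) * \<Lambda> (\<lambda>x. G x * G x)"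
proof -
  let ?a = "\<Lambda> (\<lambda>x. F x * F x)" and ?b = "\<Lambda> (\<lambda>x. F x * G x)" and ?c = "\<Lambda> (\<lambda>x. G x * G x)"
  have add: "\<Lambda> (\<lambda>x. F x + G x) = \<Lambda> F + \<Lambda> G" for F G using assms by (simp add: pos_functional_def)
  have scale: "\<Lambda> (\<lambda>x. c * F x) = c * \<Lambda> F" for c F using assms by (simp add: pos_functional_def)
  have pos: "0 \<le> s\<^sup>2 * ?a + 2 * s * t * ?b + t\<^sup>2 * ?c" for s t
  proof -
    have "0 \<le> \<Lambda> (\<lambda>x. (s * F x + t * G x)\<^sup>2)" using assms by (simp add: pos_functional_def)
    also have "(\<lambda>x. (s * F x + t * G x)\<^sup>2) = (\<lambda>x. s\<^sup>2 * (F x * F x) + (2 * s * t * (F x * G x) + t\<^sup>2 * (G x * G x)))"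
      by (simp add: power2_eq_square algebra_simps)
    finally show ?thesis by (simp only: add scale mult.assoc)
  qed
  have a: "?a \<ge> 0" using pos [of 1 0] by simp
  show ?thesis
  proof (cases "?a = 0")
    case True
    have "?b = 0"
    proof (rule ccontr)
      assume b: "?b \<noteq> 0"
      \<comment> \<open>With \<open>?a = 0\<close> and \<open>t = 1\<close> the form is affine in
        \<open>s\<close>; this \<open>s\<close> gives it the value \<open>-1\<close>.\<close>
      have "0 \<le> 2 * (- (?c + 1) / (2 * ?b)) * ?b + ?c"
        using pos [of "- (?c + 1) / (2 * ?b)" 1] True by simp
      then show False using b by (simp add: field_simps)
    qed
    then show ?thesis using True by simp
  next
    case False
    \<comment> \<open>For \<open>t = ?a\<close> the form is minimal at
      \<open>s = - ?b\<close>.\<close>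
    have "0 \<le> ?a * (?a * ?c - ?b\<^sup>2)"
      using pos [of "- ?b" ?a] by (simp add: power2_eq_square algebra_simps)
    then show ?thesis using False a by (simp add: zero_le_mult_iff)
  qed
qed

text \<open>In \<open>ev_unlabel\<close> all weights are nonnegative as soon as \<open>N \<ge> card J\<close>; integrality of \<open>N\<close> plays
  no role.\<close>

lemma ev_unlabel_functional:
  fixes N :: real
  assumes "finite D" "finite L" "N > 0" "N \<ge> 2 * n + card L"
  shows "\<exists>\<Lambda>. pos_functional \<Lambda> \<and> (\<forall>H. wf_plg H \<longrightarrow> labels H \<subseteq> L \<longrightarrow>
    ev n (plg_unlabel (- D) H) \<phi> N = \<Lambda> (\<lambda>\<phi>. ev n H \<phi> N))"
  using assms(1)
proof (induction D arbitrary: \<phi> rule: finite_induct)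
  case empty
  have "plg_unlabel (- {}) H = H" for H
    by (cases H) (auto simp: plg_unlabel_def fun_eq_iff split: option.splits)
  moreover have "pos_functional (\<lambda>F. F \<phi>)" by (simp add: pos_functional_def)
  ultimately show ?case by (intro exI [of _ "\<lambda>F. F \<phi>"]) simp
next
  case (insert l D)
  have "\<forall>\<phi>. \<exists>\<Lambda>. pos_functional \<Lambda> \<and> (\<forall>H. wf_plg H \<longrightarrow> labels H \<subseteq> L \<longrightarrow>
      ev n (plg_unlabel (- D) H) \<phi> N = \<Lambda> (\<lambda>\<phi>. ev n H \<phi> N))"
    by (intro allI insert.IH)
  from choice [OF this] obtain \<Lambda> where \<Lambda>: "\<And>\<phi>. pos_functional (\<Lambda> \<phi>)"
    "\<And>\<phi> H. wf_plg H \<Longrightarrow> labels H \<subseteq> L \<Longrightarrow>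
      ev n (plg_unlabel (- D) H) \<phi> N = \<Lambda> \<phi> (\<lambda>\<phi>. ev n H \<phi> N)"
    by blast
  \<comment> \<open>\<open>J\<close> is built from \<open>L\<close> rather than from the labels of
    one graph, so a single functional serves all graphs with labels in \<open>L\<close>.\<close>
  define J where "J = {..<2 * n} \<union> \<phi> ` L"
  have J: "finite J" using assms by (simp add: J_def)
  have "card J \<le> card {..<2 * n} + card (\<phi> ` L)" unfolding J_def by (rule card_Un_le)
  also have "\<dots> \<le> 2 * n + card L" using card_image_le [OF assms(2), of \<phi>] by simp
  finally have cardJ: "real (card J) \<le> N" using assms(4) by simp
  obtain y where y: "y \<notin> J" using J ex_new_if_finite by blast
  define \<Lambda>' where "\<Lambda>' = (\<lambda>F. ((\<Sum>x\<in>J. \<Lambda> (\<phi>(l := x)) F) + (N - card J) * \<Lambda> (\<phi>(l := y)) F) / N)"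
  have "pos_functional \<Lambda>'"
    unfolding pos_functional_def
  proof (intro conjI allI impI)
    show "\<Lambda>' (\<lambda>x. F x + G x) = \<Lambda>' F + \<Lambda>' G" for F G
      using \<Lambda>(1) assms(3) by (simp add: \<Lambda>'_def pos_functional_def sum.distrib field_simps)
    show "\<Lambda>' (\<lambda>x. c * F x) = c * \<Lambda>' F" for c F
      using \<Lambda>(1) assms(3) by (simp add: \<Lambda>'_def pos_functional_def field_simps flip: sum_distrib_left)
    fix F :: "(nat \<Rightarrow> nat) \<Rightarrow> real" assume "\<forall>x. F x \<ge> 0"
    then have "\<Lambda> \<phi> F \<ge> 0" for \<phi> using \<Lambda>(1) by (simp add: pos_functional_def)
    then show "\<Lambda>' F \<ge> 0" using assms(3) cardJ by (simp add: \<Lambda>'_def sum_nonneg)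
  qed
  moreover have "ev n (plg_unlabel (- insert l D) H) \<phi> N = \<Lambda>' (\<lambda>\<phi>. ev n H \<phi> N)"
    if H: "wf_plg H" "labels H \<subseteq> L" for H
  proof -
    let ?H = "plg_unlabel (- D) H"
    have "plg_unlabel (- insert l D) H = plg_unlabel (- {l}) ?H"
      unfolding plg_unlabel_plg_unlabel by (rule arg_cong [where f = "\<lambda>T. plg_unlabel T H"]) auto
    moreover have "wf_plg ?H" using H(1) by (rule wf_plg_unlabel)
    moreover have "{..<2 * n} \<union> \<phi> ` (labels ?H - {l}) \<subseteq> J"
      using H(2) by (auto simp: J_def labels_plg_unlabel)
    ultimately show ?thesis
      using ev_unlabel [of ?H J n \<phi> l y N] J y assms(3) by (simp add: \<Lambda>'_def \<Lambda>(2) [OF H])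
  qed
  ultimately show ?case by blast
qed

section \<open>Evaluation of derivable elements\<close>

lemma lin_diff:
  assumes "finite (supp f)" "finite (supp g)"
  shows "lin v (\<lambda>X. f X - g X) = lin v f - lin v g"
  using lin_lincomb [OF assms, of v 1 "-1"] by simp

lemma is_el_diff: "is_el f \<Longrightarrow> is_el g \<Longrightarrow> is_el (\<lambda>X. f X - g X)"
  using is_el_lincomb [of f g 1 "-1"] by simp

lemma lin_ev_pmul:
  assumes "is_el f" "is_el g" "N > 0"
  shows "lin (\<lambda>H. ev n H \<phi> N) (pmul f g) = lin (\<lambda>H. ev n H \<phi> N) f * lin (\<lambda>H. ev n H \<phi> N) g"
  using assms by (intro lin_pmul ev_plg_mult) (auto simp: is_el_def)

text \<open>The functional does not depend on \<open>f\<close>. The Cauchy-Schwarz axiom needs the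
  same functional for \<open>f1 * f1\<close>, \<open>f1 * f2\<close> and
  \<open>f2 * f2\<close>.\<close>

lemma lin_ev_unlabel_functional:
  fixes N :: real
  assumes "finite L" "N > 0" "N \<ge> 2 * n + card L"
  shows "\<exists>\<Lambda>. pos_functional \<Lambda> \<and> (\<forall>f. is_el f \<longrightarrow> (\<forall>H\<in>supp f. labels H \<subseteq> L) \<longrightarrow>
    lin (\<lambda>H. ev n H \<phi> N) (unlabel T f) = \<Lambda> (\<lambda>\<phi>. lin (\<lambda>H. ev n H \<phi> N) f))"
proof -
  obtain \<Lambda> where \<Lambda>: "pos_functional \<Lambda>" "\<And>H. wf_plg H \<Longrightarrow> labels H \<subseteq> L \<Longrightarrow>
      ev n (plg_unlabel (- (L - T)) H) \<phi> N = \<Lambda> (\<lambda>\<phi>. ev n H \<phi> N)"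
    using ev_unlabel_functional [of "L - T" L N n \<phi>] assms by auto
  have "lin (\<lambda>H. ev n H \<phi> N) (unlabel T f) = \<Lambda> (\<lambda>\<phi>. lin (\<lambda>H. ev n H \<phi> N) f)"
    if f: "is_el f" "\<forall>H\<in>supp f. labels H \<subseteq> L" for f
  proof -
    have eq: "ev n (plg_unlabel T H) \<phi> N = \<Lambda> (\<lambda>\<phi>. ev n H \<phi> N)" if "H \<in> supp f" for H
    proof -
      have H: "wf_plg H" "labels H \<subseteq> L" using f that by (auto simp: is_el_def)
      then have "plg_unlabel T H = plg_unlabel (- (L - T)) H" by (intro plg_unlabel_cong) auto
      then show ?thesis using \<Lambda>(2) [OF H] by simp
    qed
    have "lin (\<lambda>H. ev n H \<phi> N) (unlabel T f) = (\<Sum>H\<in>supp f. f H * \<Lambda> (\<lambda>\<phi>. ev n H \<phi> N))"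
      using f by (subst lin_unlabel) (auto simp: is_el_def lin_def eq)
    also have "\<dots> = (\<Sum>H\<in>supp f. \<Lambda> (\<lambda>\<phi>. f H * ev n H \<phi> N))"
      using \<Lambda>(1) by (simp add: pos_functional_def)
    also have "\<dots> = \<Lambda> (\<lambda>\<phi>. lin (\<lambda>H. ev n H \<phi> N) f)"
      unfolding lin_def by (rule pos_functional_sum [OF \<Lambda>(1), symmetric])
    finally show ?thesis .
  qed
  then show ?thesis using \<Lambda>(1) by blast
qed

text \<open>Evaluation is linear, multiplicative, invariant under isomorphism and equal to
  \<open>1\<close> on one-vertex graphs, so it annihilates the ideal.\<close>

lemma J_ideal_sound:
  assumes "f \<in> J_ideal"
  shows "is_el f \<and> (\<forall>n \<phi>. \<forall>N::real. N > 0 \<longrightarrow> lin (\<lambda>H. ev n H \<phi> N) f = 0)"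
  using assms
proof induction
  case (iso_gen H H')
  have "is_el (\<lambda>X. delta H X - delta H' X)" using iso_gen by (intro is_el_diff is_el_delta)
  then show ?case
    using iso_gen ev_iso by (simp add: lin_diff supp_delta lin_delta)
next
  case (one_vertex F)
  have "is_el (\<lambda>X. delta F X - delta empty_plg X)"
    using one_vertex wf_empty_plg by (intro is_el_diff is_el_delta)
  then show ?case
    using one_vertex by (simp add: lin_diff supp_delta lin_delta ev_one_vertex ev_empty_plg)
next
  case zero
  have "supp (\<lambda>_. 0) = {}" by (simp add: supp_def)
  then show ?case by (simp add: is_el_def lin_def)
next
  case (add f g)
  then show ?case
    using is_el_lincomb [of f g 1 1] lin_lincomb [of f g _ 1 1] by (simp add: is_el_def)
next
  case (smult f c)
  then show ?case
    using is_el_lincomb [of f f c 0] lin_lincomb [of f f _ c 0] by (simp add: is_el_def)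
next
  case (mult_left f g)
  then show ?case by (simp add: is_el_pmul lin_ev_pmul)
next
  case (mult_right f g)
  then show ?case by (simp add: is_el_pmul lin_ev_pmul)
qed

text \<open>Induction on the derivation; \<open>K\<close> grows only with the number of labels
  averaged over. It is chosen before \<open>n\<close>, so a derivation can later be refuted by an
  \<open>n\<close> depending on \<open>K\<close>.\<close>

lemma CSpos_sound:
  assumes "f \<in> CSpos"
  shows "is_el f \<and> (\<exists>K::nat. \<forall>n \<phi>. \<forall>N::real. N > 0 \<longrightarrow> N \<ge> 2 * n + K \<longrightarrow> lin (\<lambda>H. ev n H \<phi> N) f \<ge> 0)"
  using assms
proof induction
  case (A1 f)
  then show ?case by (simp add: is_el_pmul lin_ev_pmul)
next
  case (A2 L f1 f2 T)
  let ?u = "\<lambda>f g. unlabel T (pmul f g)"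
  let ?l = "\<lambda>n \<phi> N. lin (\<lambda>H. ev n H \<phi> N)"
  have el: "is_el (pmul f g)" "is_el (?u f g)" if "f \<in> {f1, f2}" "g \<in> {f1, f2}" for f g
    using that A2 by (auto intro: is_el_pmul is_el_unlabel)
  have elp: "is_el (pmul (?u f1 f1) (?u f2 f2))" "is_el (pmul (?u f1 f2) (?u f1 f2))"
    by (intro is_el_pmul is_el_unlabel A2)+
  have lab: "\<forall>H\<in>supp (pmul f g). labels H \<subseteq> L" if "f \<in> {f1, f2}" "g \<in> {f1, f2}" for f g
    using that A2 in_FL_pmul [of f L g] by (auto simp: in_FL_def)
  have "?l n \<phi> N (\<lambda>X. pmul (?u f1 f1) (?u f2 f2) X - pmul (?u f1 f2) (?u f1 f2) X) \<ge> 0"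
    if N: "N > 0" "N \<ge> 2 * n + card L" for n \<phi> and N :: real
  proof -
    obtain \<Lambda> where \<Lambda>: "pos_functional \<Lambda>" "\<And>f. is_el f \<Longrightarrow> \<forall>H\<in>supp f. labels H \<subseteq> L \<Longrightarrow>
        ?l n \<phi> N (unlabel T f) = \<Lambda> (\<lambda>\<phi>. ?l n \<phi> N f)"
      using lin_ev_unlabel_functional [of L N n \<phi> T] N A2 by auto
    have u: "?l n \<phi> N (?u f g) = \<Lambda> (\<lambda>\<phi>. ?l n \<phi> N f * ?l n \<phi> N g)" if "f \<in> {f1, f2}" "g \<in> {f1, f2}" for f g
    proof -
      have "is_el f" "is_el g" using that A2 by auto
      then show ?thesis
        using \<Lambda>(2) [OF el(1) [OF that] lab [OF that]] by (simp add: lin_ev_pmul [OF _ _ N(1)])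
    qed
    have "?l n \<phi> N (\<lambda>X. pmul (?u f1 f1) (?u f2 f2) X - pmul (?u f1 f2) (?u f1 f2) X)
        = ?l n \<phi> N (?u f1 f1) * ?l n \<phi> N (?u f2 f2) - (?l n \<phi> N (?u f1 f2))\<^sup>2"
      using elp el N by (simp add: lin_diff is_el_def [of "pmul _ _"] lin_ev_pmul power2_eq_square)
    then show ?thesis
      using pos_functional_Cauchy_Schwarz [OF \<Lambda>(1), of "\<lambda>\<phi>. ?l n \<phi> N f1" "\<lambda>\<phi>. ?l n \<phi> N f2"]
      by (simp add: u)
  qed
  then show ?case using is_el_diff [OF elp] by blast
next
  case (R1 f g \<alpha> \<beta>)
  then obtain K1 K2 :: nat where
    K1: "\<And>n \<phi> N::real. N > 0 \<Longrightarrow> N \<ge> 2 * n + K1 \<Longrightarrow> lin (\<lambda>H. ev n H \<phi> N) f \<ge> 0" and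
    K2: "\<And>n \<phi> N::real. N > 0 \<Longrightarrow> N \<ge> 2 * n + K2 \<Longrightarrow> lin (\<lambda>H. ev n H \<phi> N) g \<ge> 0" by auto
  have "lin (\<lambda>H. ev n H \<phi> N) (\<lambda>X. \<alpha> * f X + \<beta> * g X) \<ge> 0"
    if "N > 0" "N \<ge> 2 * n + max K1 K2" for n \<phi> and N :: real
    using R1 that K1 [of N n \<phi>] K2 [of N n \<phi>] by (subst lin_lincomb) (auto simp: is_el_def)
  moreover have "is_el (\<lambda>X. \<alpha> * f X + \<beta> * g X)" using R1 by (simp add: is_el_lincomb)
  ultimately show ?case by blast
next
  case (R2 f g)
  then obtain K1 K2 :: nat where
    K1: "\<And>n \<phi> N::real. N > 0 \<Longrightarrow> N \<ge> 2 * n + K1 \<Longrightarrow> lin (\<lambda>H. ev n H \<phi> N) f \<ge> 0" and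
    K2: "\<And>n \<phi> N::real. N > 0 \<Longrightarrow> N \<ge> 2 * n + K2 \<Longrightarrow> lin (\<lambda>H. ev n H \<phi> N) g \<ge> 0" by auto
  have "lin (\<lambda>H. ev n H \<phi> N) (pmul f g) \<ge> 0"
    if "N > 0" "N \<ge> 2 * n + max K1 K2" for n \<phi> and N :: real
    using R2 that K1 [of N n \<phi>] K2 [of N n \<phi>] by (subst lin_ev_pmul) auto
  moreover have "is_el (pmul f g)" using R2 by (simp add: is_el_pmul)
  ultimately show ?case by blast
next
  case (R3 f T)
  then obtain K :: nat where el: "is_el f" and
    K: "\<And>n \<phi> N::real. N > 0 \<Longrightarrow> N \<ge> 2 * n + K \<Longrightarrow> lin (\<lambda>H. ev n H \<phi> N) f \<ge> 0" by auto
  \<comment> \<open>Averaging over labels is a positive operation once \<open>N\<close> is at least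
    \<open>2 * n\<close> plus the number of labels in \<open>f\<close>, so this number enters the
    new bound.\<close>
  define L where "L = \<Union> (labels ` supp f)"
  have L: "finite L" "\<forall>H\<in>supp f. labels H \<subseteq> L"
    using el finite_labels by (auto simp: L_def is_el_def)
  have "lin (\<lambda>H. ev n H \<phi> N) (unlabel T f) \<ge> 0"
    if N: "N > 0" "N \<ge> 2 * n + max K (card L)" for n \<phi> and N :: real
  proof -
    have "N \<ge> 2 * n + card L" using N(2) by linarith
    then obtain \<Lambda> where \<Lambda>: "pos_functional \<Lambda>"
      "lin (\<lambda>H. ev n H \<phi> N) (unlabel T f) = \<Lambda> (\<lambda>\<phi>. lin (\<lambda>H. ev n H \<phi> N) f)"
      using lin_ev_unlabel_functional [OF L(1), of N n \<phi> T] N(1) el L(2) by auto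
    have "lin (\<lambda>H. ev n H \<phi> N) f \<ge> 0" for \<phi> using N by (intro K) auto
    then show ?thesis using \<Lambda> by (simp add: pos_functional_def)
  qed
  then show ?case using is_el_unlabel [OF el] by blast
next
  case (congr f g)
  then obtain K :: nat where el: "is_el f" and
    K: "\<And>n \<phi> N::real. N > 0 \<Longrightarrow> N \<ge> 2 * n + K \<Longrightarrow> lin (\<lambda>H. ev n H \<phi> N) f \<ge> 0" by auto
  have "lin (\<lambda>H. ev n H \<phi> N) f = lin (\<lambda>H. ev n H \<phi> N) g" if "N > 0" for n \<phi> and N :: real
    using J_ideal_sound [OF congr(3)] that el congr(2) by (simp add: lin_diff is_el_def)
  then show ?case using K congr(2) by metis
qed

section \<open>Densities of cycles\<close>

text \<open>The entries of the \<open>k\<close>-th power of the matrix \<open>a\<close> on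
  \<open>V\<close>, with the recursion at the last step as for powers of \<open>mat\<close>.\<close>

fun walks :: "(nat \<Rightarrow> nat \<Rightarrow> real) \<Rightarrow> nat set \<Rightarrow> nat \<Rightarrow> nat \<Rightarrow> nat \<Rightarrow> real" where
  "walks a V 0 x y = of_bool (x = y)"
| "walks a V (Suc k) x y = (\<Sum>z\<in>V. walks a V k x z * a z y)"

definition adj :: "nat set set \<Rightarrow> nat \<Rightarrow> nat \<Rightarrow> real" where
  "adj EG x y = of_bool ({x, y} \<in> EG)"

text \<open>The weight \<open>G\<close> of the two endpoints is arbitrary, so that the induction can
  absorb the last step of a path into it. Later \<open>G\<close> is the edge that closes the
  cycle.\<close>

lemma sum_PiE_walks:
  assumes "finite V"
  shows "(\<Sum>\<psi>\<in>{..<Suc k} \<rightarrow>\<^sub>E V. (\<Prod>i<k. a (\<psi> i) (\<psi> (Suc i))) * G (\<psi> 0) (\<psi> k))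
    = (\<Sum>x\<in>V. \<Sum>y\<in>V. walks a V k x y * G x y)"
proof -
  have split: "(\<Sum>\<psi>\<in>insert k A \<rightarrow>\<^sub>E V. h \<psi>) = (\<Sum>\<psi>\<in>A \<rightarrow>\<^sub>E V. \<Sum>y\<in>V. h (\<psi>(k := y)))"
    if "k \<notin> A" for k and A :: "nat set" and h :: "(nat \<Rightarrow> nat) \<Rightarrow> real"
  proof -
    have "(\<Sum>\<psi>\<in>insert k A \<rightarrow>\<^sub>E V. h \<psi>) = (\<Sum>p\<in>V \<times> (A \<rightarrow>\<^sub>E V). h ((\<lambda>(y, g). g(k := y)) p))"
      unfolding PiE_insert_eq
      by (subst sum.reindex) (use inj_combinator [OF that, of "\<lambda>_. V"] in \<open>auto simp: comp_def\<close>)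
    also have "\<dots> = (\<Sum>y\<in>V. \<Sum>\<psi>\<in>A \<rightarrow>\<^sub>E V. h (\<psi>(k := y)))"
      by (simp add: sum.cartesian_product case_prod_beta)
    also have "\<dots> = (\<Sum>\<psi>\<in>A \<rightarrow>\<^sub>E V. \<Sum>y\<in>V. h (\<psi>(k := y)))" by (rule sum.swap)
    finally show ?thesis .
  qed
  show ?thesis
  proof (induction k arbitrary: G)
    case 0
    have "(\<Sum>\<psi>\<in>{..<Suc 0} \<rightarrow>\<^sub>E V. G (\<psi> 0) (\<psi> 0)) = (\<Sum>y\<in>V. G y y)"
      using split [of 0 "{}" "\<lambda>\<psi>. G (\<psi> 0) (\<psi> 0)"] by (simp add: lessThan_Suc)
    then show ?case using assms by (simp add: sum.delta)
  next
    case (Suc k)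
    have "(\<Sum>\<psi>\<in>{..<Suc (Suc k)} \<rightarrow>\<^sub>E V. (\<Prod>i<Suc k. a (\<psi> i) (\<psi> (Suc i))) * G (\<psi> 0) (\<psi> (Suc k)))
      = (\<Sum>\<psi>\<in>{..<Suc k} \<rightarrow>\<^sub>E V. \<Sum>y\<in>V. (\<Prod>i<k. a (\<psi> i) (\<psi> (Suc i))) * a (\<psi> k) y * G (\<psi> 0) y)"
      unfolding lessThan_Suc [of "Suc k"] by (subst split) simp_all
    also have "\<dots> = (\<Sum>\<psi>\<in>{..<Suc k} \<rightarrow>\<^sub>E V. (\<Prod>i<k. a (\<psi> i) (\<psi> (Suc i))) * (\<Sum>y\<in>V. a (\<psi> k) y * G (\<psi> 0) y))"
      by (simp add: sum_distrib_left mult.assoc)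
    also have "\<dots> = (\<Sum>x\<in>V. \<Sum>z\<in>V. walks a V k x z * (\<Sum>y\<in>V. a z y * G x y))"
      by (rule Suc.IH)
    also have "\<dots> = (\<Sum>x\<in>V. \<Sum>z\<in>V. \<Sum>y\<in>V. walks a V k x z * a z y * G x y)"
      by (simp add: sum_distrib_left mult.assoc)
    also have "\<dots> = (\<Sum>x\<in>V. \<Sum>y\<in>V. \<Sum>z\<in>V. walks a V k x z * a z y * G x y)"
      by (intro sum.cong refl sum.swap)
    finally show ?case by (simp add: sum_distrib_right)
  qed
qed

text \<open>For \<open>k = 2\<close> the two edges coincide and the graph is a single edge. For
  \<open>k = 1\<close> the only edge would be a singleton, hence the bound in
  \<open>wf_cyc\<close>.\<close>

definition cyc :: "nat \<Rightarrow> plg" where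
  "cyc k = \<lparr>pV = {..<k}, pE = (\<lambda>i. {i, Suc i mod k}) ` {..<k}, plab = (\<lambda>_. None)\<rparr>"

lemma wf_cyc: "k \<ge> 2 \<Longrightarrow> wf_plg (cyc k)"
  by (auto simp: wf_plg_def cyc_def mod_Suc card_insert_if)

lemma labels_cyc: "labels (cyc k) = {}"
  by (simp add: labels_def cyc_def)

text \<open>Homomorphisms from a cycle are closed walks, counted by the trace of a matrix
  power.\<close>

lemma tdens_cyc:
  assumes "finite VG"
  shows "tdens (cyc (Suc k)) VG EG \<phi> = (\<Sum>x\<in>VG. walks (adj EG) VG (Suc k) x x) / real (card VG) ^ Suc k"
proof -
  let ?a = "adj EG"
  have U: "unlabeled_vertices (cyc (Suc k)) = {..<Suc k}" by (auto simp: unlabeled_vertices_def cyc_def)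
  have homs: "homs (cyc (Suc k)) VG EG \<phi> = {\<psi> \<in> {..<Suc k} \<rightarrow>\<^sub>E VG. \<forall>i<Suc k. {\<psi> i, \<psi> (Suc i mod Suc k)} \<in> EG}"
    unfolding homs_def U by (auto simp: is_hom_def assignment_def cyc_def)
  have fin: "finite ({..<Suc k} \<rightarrow>\<^sub>E VG)" using assms by (simp add: finite_PiE)
  have "real (card (homs (cyc (Suc k)) VG EG \<phi>))
      = (\<Sum>\<psi>\<in>{..<Suc k} \<rightarrow>\<^sub>E VG. of_bool (\<forall>i<Suc k. {\<psi> i, \<psi> (Suc i mod Suc k)} \<in> EG))"
    unfolding homs using fin by (simp add: of_bool_def sum.If_cases Int_def)
  also have "\<dots> = (\<Sum>\<psi>\<in>{..<Suc k} \<rightarrow>\<^sub>E VG. (\<Prod>i<k. ?a (\<psi> i) (\<psi> (Suc i))) * ?a (\<psi> k) (\<psi> 0))"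
  proof (rule sum.cong [OF refl])
    fix \<psi>
    have prod: "(\<Prod>i<m. of_bool (P i)) = (of_bool (\<forall>i<m. P i) :: real)" for m :: nat and P
      by (induction m) (auto simp: less_Suc_eq)
    have "(\<Prod>i<k. ?a (\<psi> i) (\<psi> (Suc i))) * ?a (\<psi> k) (\<psi> 0) = (\<Prod>i<Suc k. ?a (\<psi> i) (\<psi> (Suc i mod Suc k)))"
      by (simp add: mod_Suc)
    then show "of_bool (\<forall>i<Suc k. {\<psi> i, \<psi> (Suc i mod Suc k)} \<in> EG)
        = (\<Prod>i<k. ?a (\<psi> i) (\<psi> (Suc i))) * ?a (\<psi> k) (\<psi> 0)"
      unfolding adj_def prod by simp
  qed
  also have "\<dots> = (\<Sum>x\<in>VG. \<Sum>y\<in>VG. walks ?a VG k x y * ?a y x)"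
    by (rule sum_PiE_walks [OF assms, where G = "\<lambda>x y. ?a y x"])
  also have "\<dots> = (\<Sum>x\<in>VG. walks ?a VG (Suc k) x x)" by simp
  finally show ?thesis by (simp add: tdens_homs U)
qed

section \<open>Cycles in the model\<close>

lemma partner_partner: "partner n (partner n x) = x"
  unfolding partner_def by (auto elim!: evenE oddE)

lemma partner_eq_iff: "partner n x = x \<longleftrightarrow> \<not> x < 2 * n"
  unfolding partner_def by (auto elim: oddE)

lemma adj_model: "adj (model_edges n) x y = of_bool (y = partner n x)"
  unfolding adj_def model_edges_def using partner_partner [of n] by (auto simp: doubleton_eq_iff)

text \<open>The adjacency matrix is the permutation matrix of the involution
  \<open>partner n\<close>; \<open>2 * n \<le> M\<close> keeps both ends of every edge
  inside.\<close>

lemma walks_model: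
  assumes "x < M" "2 * n \<le> M"
  shows "walks (adj (model_edges n)) {..<M} k x y = of_bool (y = (partner n ^^ k) x)"
proof (induction k arbitrary: y)
  case (Suc k)
  have "(partner n ^^ k) x < M"
  proof (induction k)
    case (Suc k)
    then show ?case using assms partner_less_iff [of n "(partner n ^^ k) x"]
      by (cases "(partner n ^^ k) x < 2 * n") (auto simp: partner_def)
  qed (use assms in auto)
  moreover have "walks (adj (model_edges n)) {..<M} (Suc k) x y
      = (\<Sum>z<M. if z = (partner n ^^ k) x then of_bool (y = partner n z) else 0)"
    unfolding walks.simps Suc adj_model by (intro sum.cong) auto
  ultimately show ?case by simp
qed auto

text \<open>An even power of the involution is the identity, with trace \<open>N\<close>; an odd
  power fixes exactly the loops, which number \<open>N - 2 * n\<close>.\<close>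

lemma ev_cyc:
  assumes "k \<ge> 2" "N > 0"
  shows "ev n (cyc k) \<phi> N = (if even k then N else N - 2 * n) / N ^ k"
proof (rule ev_eqI [OF wf_cyc [OF assms(1)] _ _ assms(2)])
  obtain k' where k': "k = Suc k'" using assms by (cases k) auto
  show "rat_fun (\<lambda>N. (if even k then N else N - 2 * n) / N ^ k)"
    unfolding rat_fun_def
    by (rule exI [of _ "[:if even k then 0 else - real (2 * n), 1:]"], rule exI [of _ k]) simp
  have pw: "(partner n ^^ k) x = (if even k then x else partner n x)" for x
    by (induction k) (auto simp: partner_partner)
  show "\<forall>\<^sub>F M in sequentially. tdens (cyc k) {..<M} (model_edges n) \<phi>
      = (if even k then real M else real M - 2 * n) / real M ^ k"
    using eventually_ge_at_top [of "2 * n"]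
  proof eventually_elim
    case (elim M)
    have "(\<Sum>x<M. walks (adj (model_edges n)) {..<M} k x x) = (\<Sum>x<M. of_bool (even k \<or> x \<notin> {..<2 * n}))"
      using elim by (intro sum.cong) (auto simp: walks_model pw partner_eq_iff eq_commute [of _ "partner _ _"])
    also have "\<dots> = (if even k then real M else real M - 2 * n)"
    proof (cases "even k")
      case False
      have "(\<Sum>x<M. of_bool (x \<notin> {..<2 * n})) = real (card ({..<M} - {..<2 * n}))"
        by (simp add: of_bool_def sum.If_cases Int_def set_diff_eq)
      also have "\<dots> = real M - 2 * n" using elim by (simp add: card_Diff_subset of_nat_diff)
      finally show ?thesis using False by simp
    qed simp
    finally show ?case using tdens_cyc [of "{..<M}" k' "model_edges n" \<phi>] by (simp add: k')
  qed
qed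

section \<open>Power sums of eigenvalues\<close>

definition tr :: "complex mat \<Rightarrow> complex" where
  "tr A = (\<Sum>i<dim_row A. A $$ (i, i))"

lemma tr_mult_commute:
  assumes "A \<in> carrier_mat n n" "B \<in> carrier_mat n n"
  shows "tr (A * B) = tr (B * A)"
proof -
  have "tr (A * B) = (\<Sum>i<n. \<Sum>j<n. A $$ (i, j) * B $$ (j, i))"
    using assms by (auto simp: tr_def scalar_prod_def atLeast0LessThan intro!: sum.cong)
  also have "\<dots> = (\<Sum>j<n. \<Sum>i<n. B $$ (j, i) * A $$ (i, j))"
    by (subst sum.swap) (simp add: mult.commute)
  also have "\<dots> = tr (B * A)"
    using assms by (auto simp: tr_def scalar_prod_def atLeast0LessThan intro!: sum.cong)
  finally show ?thesis .
qed

lemma upper_triangular_pow: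
  fixes B :: "complex mat"
  assumes "B \<in> carrier_mat n n" "upper_triangular B"
  shows "upper_triangular (B ^\<^sub>m k) \<and> (\<forall>i<n. (B ^\<^sub>m k) $$ (i, i) = (B $$ (i, i)) ^ k)"
proof (induction k)
  case 0
  show ?case using assms by auto
next
  case (Suc k)
  let ?C = "B ^\<^sub>m k"
  have C: "?C \<in> carrier_mat n n" using assms by simp
  have entry: "(?C * B) $$ (i, j) = (\<Sum>l<n. ?C $$ (i, l) * B $$ (l, j))" if "i < n" "j < n" for i j
    using that C assms by (auto simp: scalar_prod_def atLeast0LessThan intro!: sum.cong)
  \<comment> \<open>By triangularity a term of the product survives only for
    \<open>i \<le> l\<close> and \<open>l \<le> j\<close>.\<close>
  have zero: "?C $$ (i, l) * B $$ (l, j) = 0" if "i < n" "j < n" "l < n" "l < i \<or> j < l" for i j l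
    using that Suc assms C unfolding upper_triangular_def by auto
  have "(?C * B) $$ (i, j) = 0" if "i < n" "j < i" for i j
    unfolding entry [OF that(1) less_trans [OF that(2,1)]]
    using that by (intro sum.neutral ballI zero) auto
  moreover have "(?C * B) $$ (i, i) = (B $$ (i, i)) ^ Suc k" if "i < n" for i
  proof -
    have "(?C * B) $$ (i, i) = (\<Sum>l\<in>{i}. ?C $$ (i, l) * B $$ (l, i))"
      unfolding entry [OF that that] using that by (intro sum.mono_neutral_right ballI zero) auto
    then show ?thesis using Suc that by (simp add: mult.commute)
  qed
  ultimately show ?case using C assms(1) unfolding upper_triangular_def by auto
qed

text \<open>For an eigenvector \<open>v\<close> the Hermitian form at \<open>v\<close> is real by
  symmetry, and it equals \<mu> times the positive squared norm of \<open>v\<close>.\<close>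

lemma eigenvalue_real_symmetric:
  fixes a :: "nat \<Rightarrow> nat \<Rightarrow> real"
  assumes sym: "\<And>i j. i < n \<Longrightarrow> j < n \<Longrightarrow> a i j = a j i"
    and ev: "eigenvalue (mat n n (\<lambda>(i, j). complex_of_real (a i j))) \<mu>"
  shows "\<mu> \<in> \<real>"
proof -
  let ?A = "mat n n (\<lambda>(i, j). complex_of_real (a i j))"
  obtain v where v: "v \<in> carrier_vec n" "v \<noteq> 0\<^sub>v n" "?A *\<^sub>v v = \<mu> \<cdot>\<^sub>v v"
    using ev unfolding eigenvalue_def eigenvector_def by auto
  have Av: "(\<Sum>j<n. complex_of_real (a i j) * v $ j) = \<mu> * v $ i" if "i < n" for i
  proof -
    have "(?A *\<^sub>v v) $ i = (\<Sum>j<n. complex_of_real (a i j) * v $ j)"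
      using that v(1) by (auto simp: scalar_prod_def atLeast0LessThan intro!: sum.cong)
    then show ?thesis using v that by simp
  qed
  define q where "q = (\<Sum>i<n. \<Sum>j<n. cnj (v $ i) * (complex_of_real (a i j) * v $ j))"
  define s where "s = (\<Sum>i<n. (cmod (v $ i))\<^sup>2)"
  have q: "q = \<mu> * complex_of_real s"
  proof -
    have "q = (\<Sum>i<n. cnj (v $ i) * (\<mu> * v $ i))"
      unfolding q_def sum_distrib_left [symmetric] by (intro sum.cong) (auto simp: Av)
    also have "\<dots> = (\<Sum>i<n. \<mu> * complex_of_real ((cmod (v $ i))\<^sup>2))"
      by (intro sum.cong refl) (simp only: complex_norm_square mult_ac)
    finally show ?thesis by (simp add: s_def sum_distrib_left)
  qed
  have "cnj q = (\<Sum>i<n. \<Sum>j<n. cnj (v $ j) * (complex_of_real (a j i) * v $ i))"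
    unfolding q_def cnj_sum using sym by (intro sum.cong) (auto simp: mult_ac)
  also have "\<dots> = q" unfolding q_def by (rule sum.swap)
  finally have q_real: "q \<in> \<real>" by (simp add: Reals_cnj_iff)
  obtain i where i: "i < n" "v $ i \<noteq> 0"
    using v(1,2) by (metis carrier_vecD eq_vecI index_zero_vec(1) index_zero_vec(2))
  have "s > 0" unfolding s_def using i by (intro sum_pos2 [of _ i]) auto
  then have "\<mu> = q / complex_of_real s" using q by simp
  then show ?thesis using q_real by simp
qed

text \<open>Schur triangularization over the complex numbers: traces of powers are similarity
  invariants, the diagonal carries the eigenvalues, and these are real by symmetry.\<close>

lemma walks_power_sum:
  assumes "finite V" and sym: "\<And>x y. a x y = a y x"
  shows "\<exists>\<mu>::nat \<Rightarrow> real. \<forall>k. (\<Sum>x\<in>V. walks a V k x x) = (\<Sum>i<card V. \<mu> i ^ k)"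
proof -
  define n where "n = card V"
  obtain b where b: "bij_betw b {..<n} V"
    using ex_bij_betw_nat_finite [OF assms(1)] by (auto simp: n_def atLeast0LessThan)
  define A where "A = mat n n (\<lambda>(i, j). complex_of_real (a (b i) (b j)))"
  have A: "A \<in> carrier_mat n n" by (simp add: A_def)
  obtain es where es: "char_poly A = (\<Prod>e\<leftarrow>es. [:- e, 1:])" "length es = n"
    using char_poly_factorized [OF A] by auto
  obtain B P Q where dec: "schur_decomposition A es = (B, P, Q)" by (cases "schur_decomposition A es") auto
  from schur_decomposition [OF A es(1) dec]
  have wit: "similar_mat_wit A B P Q" and ut: "upper_triangular B" and diag: "diag_mat B = es" by auto
  note D = similar_mat_witD2 [OF A wit]
  have real: "es ! i \<in> \<real>" if "i < n" for i
  proof -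
    have "eigenvalue A (es ! i)"
      unfolding eigenvalue_root_char_poly [OF A] es(1) using that es(2)
      by (auto simp: poly_prod_list prod_list_zero_iff image_iff intro!: bexI [of _ "es ! i"])
    then show ?thesis
      unfolding A_def by (rule eigenvalue_real_symmetric [rotated]) (rule sym)
  qed
  have Bi: "B $$ (i, i) = es ! i" if "i < n" for i
    using that D(5) unfolding diag [symmetric] diag_mat_def by simp
  have pow: "(A ^\<^sub>m k) $$ (i, j) = complex_of_real (walks a V k (b i) (b j))" if "i < n" "j < n" for i j k
    using that
  proof (induction k arbitrary: j)
    case 0
    then show ?case using A b by (auto simp: bij_betw_def inj_on_def)
  next
    case (Suc k)
    have "(A ^\<^sub>m Suc k) $$ (i, j) = (\<Sum>l<n. (A ^\<^sub>m k) $$ (i, l) * A $$ (l, j))"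
      using Suc.prems A by (auto simp: scalar_prod_def atLeast0LessThan intro!: sum.cong)
    also have "\<dots> = (\<Sum>l<n. complex_of_real (walks a V k (b i) (b l) * a (b l) (b j)))"
      using Suc by (intro sum.cong) (auto simp: A_def)
    also have "\<dots> = complex_of_real (\<Sum>l<n. walks a V k (b i) (b l) * a (b l) (b j))" by simp
    also have "(\<Sum>l<n. walks a V k (b i) (b l) * a (b l) (b j)) = (\<Sum>z\<in>V. walks a V k (b i) z * a z (b j))"
      by (rule sum.reindex_bij_betw [OF b])
    finally show ?case by simp
  qed
  have "(\<Sum>x\<in>V. walks a V k x x) = (\<Sum>i<n. Re (es ! i) ^ k)" for k
  proof -
    have "complex_of_real (\<Sum>x\<in>V. walks a V k x x) = complex_of_real (\<Sum>i<n. walks a V k (b i) (b i))"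
      using sum.reindex_bij_betw [OF b, of "\<lambda>x. walks a V k x x"] by simp
    also have "\<dots> = tr (A ^\<^sub>m k)" using A by (simp add: tr_def pow)
    also have "\<dots> = tr (P * (B ^\<^sub>m k * Q))"
      using similar_mat_wit_pow_id [OF wit, of k] D by (simp add: assoc_mult_mat [of _ n n _ n _ n])
    also have "\<dots> = tr (B ^\<^sub>m k * Q * P)" using D by (intro tr_mult_commute [of _ n]) auto
    also have "B ^\<^sub>m k * Q * P = B ^\<^sub>m k"
      using D by (simp add: assoc_mult_mat [of _ n n _ n _ n] right_mult_one_mat [of _ n n])
    also have "tr (B ^\<^sub>m k) = (\<Sum>i<n. (es ! i) ^ k)"
      using D(5) upper_triangular_pow [OF D(5) ut, of k] by (simp add: tr_def Bi)
    also have "\<dots> = (\<Sum>i<n. complex_of_real (Re (es ! i)) ^ k)"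
      using real by (intro sum.cong) auto
    also have "\<dots> = complex_of_real (\<Sum>i<n. Re (es ! i) ^ k)" by simp
    finally show ?thesis by (simp only: of_real_eq_iff)
  qed
  then show ?thesis unfolding n_def by (intro exI [of _ "\<lambda>i. Re (es ! i)"]) simp
qed

section \<open>An inequality for power sums\<close>

text \<open>Cross terms in the square are nonnegative. For equal second and fourth power sums
  \<open>N > 0\<close> this yields \<open>N \<ge> 1\<close>.\<close>

lemma sum_power4_le_square:
  fixes s :: "'a \<Rightarrow> real"
  assumes "finite I"
  shows "(\<Sum>i\<in>I. s i ^ 4) \<le> (\<Sum>i\<in>I. s i ^ 2)\<^sup>2"
  using assms
proof (induction I)
  case (insert i I)
  have "0 \<le> s i ^ 2 * (\<Sum>i\<in>I. s i ^ 2)" by (simp add: sum_nonneg)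
  moreover have "s i ^ 4 = (s i ^ 2)\<^sup>2" by (simp flip: power_mult)
  ultimately show ?case using insert by (simp add: power2_sum)
qed simp

text \<open>Replacing \<open>s\<^sup>2\<close> by \<open>2 * s\<^sup>2 - s\<^sup>4\<close>, which has the same sum when \<open>\<Sum>s\<^sup>2 = \<Sum>s\<^sup>4\<close>, makes the
  error quadratic near \<open>s\<^sup>2 = 1\<close>.\<close>

lemma count_error:
  fixes s :: real
  shows "\<bar>2 * s ^ 2 - s ^ 4 - of_bool (s ^ 2 \<ge> 1/2)\<bar> \<le> 8 * (s\<^sup>2 * (s\<^sup>2 - 1)\<^sup>2)"
proof -
  define t where "t = s\<^sup>2"
  have t: "t \<ge> 0" "s ^ 4 = t\<^sup>2" by (simp_all add: t_def flip: power_mult)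
  show ?thesis
  proof (cases "t \<ge> 1/2")
    case True
    have "\<bar>2 * t - t\<^sup>2 - 1\<bar> = (t - 1)\<^sup>2" by (subst abs_of_nonpos) (use zero_le_power2 [of "t - 1"] in \<open>simp_all add: power2_diff\<close>)
    also have "\<dots> \<le> 8 * (t * (t - 1)\<^sup>2)"
      using mult_right_mono [of 1 "8 * t" "(t - 1)\<^sup>2"] True by (simp add: mult.assoc)
    finally show ?thesis using True t by (simp flip: t_def)
  next
    case False
    have "\<bar>2 * t - t\<^sup>2\<bar> = t * (2 - t)" using False t by (subst abs_of_nonneg) (auto simp: power2_eq_square algebra_simps mult_left_le_one_le intro: mult_mono)
    also have "\<dots> \<le> t * 2" using t by (intro mult_left_mono) auto
    also have "\<dots> \<le> t * (8 * (t - 1)\<^sup>2)"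
    proof (rule mult_left_mono [OF _ t(1)])
      have "(1/2)\<^sup>2 \<le> (1 - t)\<^sup>2" using False by (intro power_mono) auto
      then show "2 \<le> 8 * (t - 1)\<^sup>2" by (simp add: power2_eq_square algebra_simps)
    qed
    finally show ?thesis using False t by (simp add: algebra_simps flip: t_def)
  qed
qed

text \<open>The error of the cube is of first order in \<open>u^2 - 1\<close>. The parameter
  \<epsilon> trades it for a small multiple of \<open>u^2\<close> and a quadratic error, both of
  which can be summed.\<close>

lemma cube_error_nonneg:
  fixes u \<epsilon> :: real
  assumes "u \<ge> 0" "0 < \<epsilon>" "\<epsilon> \<le> 1"
  shows "\<bar>u ^ 3 - of_bool (u ^ 2 \<ge> 1/2)\<bar> \<le> 3 * (\<epsilon> * u\<^sup>2 + u\<^sup>2 * (u\<^sup>2 - 1)\<^sup>2 / \<epsilon>)"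
proof (cases "u\<^sup>2 \<ge> 1/2")
  case True
  \<comment> \<open>A rational lower bound for \<open>sqrt (1/2)\<close>.\<close>
  have u: "u \<ge> 2/3"
  proof (rule ccontr)
    assume "\<not> u \<ge> 2/3"
    then have "u\<^sup>2 \<le> (2/3)\<^sup>2" using assms by (intro power_mono) auto
    then show False using True by (simp add: power2_eq_square)
  qed
  have "u\<^sup>2 + u + 1 \<le> 3 * u\<^sup>2 * (u + 1)"
  proof -
    \<comment> \<open>Division of \<open>3 * u^2 * (u + 1) - (u^2 + u + 1)\<close> by
      \<open>u - 2/3\<close>; the remainder is \<open>1/9\<close>.\<close>
    have "0 \<le> (u - 2/3) * (3 * u\<^sup>2 + 4 * u + 5/3)" using u by (intro mult_nonneg_nonneg) auto
    also have "\<dots> \<le> 3 * u\<^sup>2 * (u + 1) - (u\<^sup>2 + u + 1)" by (simp add: power2_eq_square algebra_simps)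
    finally show ?thesis by simp
  qed
  then have "\<bar>u - 1\<bar> * (u\<^sup>2 + u + 1) \<le> \<bar>u - 1\<bar> * (3 * u\<^sup>2 * (u + 1))"
    by (intro mult_left_mono) auto
  moreover have "\<bar>u ^ 3 - 1\<bar> = \<bar>u - 1\<bar> * (u\<^sup>2 + u + 1)"
  proof -
    have "u ^ 3 - 1 = (u - 1) * (u\<^sup>2 + u + 1)" by (simp add: power2_eq_square power3_eq_cube algebra_simps)
    then show ?thesis using assms by (simp add: abs_mult)
  qed
  moreover have "\<bar>u\<^sup>2 - 1\<bar> = \<bar>u - 1\<bar> * (u + 1)"
  proof -
    have "u\<^sup>2 - 1 = (u - 1) * (u + 1)" by (simp add: power2_eq_square algebra_simps)
    then show ?thesis using assms by (simp add: abs_mult)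
  qed
  ultimately have "\<bar>u ^ 3 - 1\<bar> \<le> 3 * (u\<^sup>2 * \<bar>u\<^sup>2 - 1\<bar>)" by (simp add: mult_ac)
  also have "\<dots> \<le> 3 * (u\<^sup>2 * (\<epsilon> + (u\<^sup>2 - 1)\<^sup>2 / \<epsilon>))"
  proof -
    define z where "z = \<bar>u\<^sup>2 - 1\<bar>"
    have "0 \<le> (z - \<epsilon>)\<^sup>2 + z * \<epsilon>" using assms by (simp add: z_def)
    then have "z * \<epsilon> \<le> \<epsilon>\<^sup>2 + z\<^sup>2" by (simp add: power2_eq_square algebra_simps)
    then have "z \<le> \<epsilon> + z\<^sup>2 / \<epsilon>" using assms by (simp add: field_simps power2_eq_square)
    then have "\<bar>u\<^sup>2 - 1\<bar> \<le> \<epsilon> + (u\<^sup>2 - 1)\<^sup>2 / \<epsilon>" by (simp add: z_def)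
    then show ?thesis by (simp add: mult_left_mono)
  qed
  finally show ?thesis using True by (simp add: algebra_simps)
next
  case False
  \<comment> \<open>A rational upper bound for \<open>sqrt (1/2)\<close>, equal to
    \<open>3 * (1/2)^2\<close>; one factor \<open>u\<close> is thus at most
    \<open>3 * (u^2 - 1)^2\<close>.\<close>
  have u: "u \<le> 3/4"
  proof (rule ccontr)
    assume "\<not> u \<le> 3/4"
    then have "(3/4)\<^sup>2 \<le> u\<^sup>2" by (intro power_mono) auto
    then show False using False by (simp add: power2_eq_square)
  qed
  have *: "(1/2)\<^sup>2 \<le> (1 - u\<^sup>2)\<^sup>2" using False by (intro power_mono) auto
  have "u ^ 3 = u\<^sup>2 * u" by (simp add: power2_eq_square power3_eq_cube)
  also have "\<dots> \<le> u\<^sup>2 * (3 * (u\<^sup>2 - 1)\<^sup>2)"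
    using u * by (intro mult_left_mono) (auto simp: power2_commute [of 1] power2_eq_square [of "1/2"])
  also have "\<dots> = 3 * (u\<^sup>2 * (u\<^sup>2 - 1)\<^sup>2)" by simp
  also have "\<dots> \<le> 3 * (u\<^sup>2 * (u\<^sup>2 - 1)\<^sup>2 / \<epsilon>)"
  proof -
    have "a \<le> a / \<epsilon>" if "a \<ge> 0" for a
      using that assms by (simp add: pos_le_divide_eq mult_left_le)
    then show ?thesis by simp
  qed
  also have "\<dots> \<le> 3 * (\<epsilon> * u\<^sup>2 + u\<^sup>2 * (u\<^sup>2 - 1)\<^sup>2 / \<epsilon>)" using assms by simp
  finally show ?thesis using False assms by simp
qed

lemma cube_error:
  fixes s \<epsilon> :: real
  assumes "0 < \<epsilon>" "\<epsilon> \<le> 1"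
  shows "\<bar>s ^ 3 - of_bool (s ^ 2 \<ge> 1/2) * sgn s\<bar> \<le> 3 * (\<epsilon> * s\<^sup>2 + s\<^sup>2 * (s\<^sup>2 - 1)\<^sup>2 / \<epsilon>)"
proof -
  have "\<bar>s ^ 3 - of_bool (s ^ 2 \<ge> 1/2) * sgn s\<bar> = \<bar>\<bar>s\<bar> ^ 3 - of_bool (\<bar>s\<bar> ^ 2 \<ge> 1/2)\<bar>"
    by (cases s "0::real" rule: linorder_cases) (auto simp: of_bool_def)
  then show ?thesis using cube_error_nonneg [of "\<bar>s\<bar>"] assms by simp
qed

text \<open>If the error \<open>\<tau>\<close> is small then \<open>N\<close> and \<open>S\<^sup>2\<close> are close to integers,
  so \<open>2 * S\<^sup>2 - 2 * N - 1\<close> is close to an odd integer.\<close>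

lemma normalized_inequality:
  fixes s :: "'a \<Rightarrow> real"
  assumes fin: "finite I"
    and N: "N = (\<Sum>i\<in>I. s i ^ 2)" "N = (\<Sum>i\<in>I. s i ^ 4)" "N > 0"
    and S: "S = (\<Sum>i\<in>I. s i ^ 3)"
    and \<tau>: "\<tau> = (\<Sum>i\<in>I. (s i)\<^sup>2 * ((s i)\<^sup>2 - 1)\<^sup>2)"
  shows "(2 * S\<^sup>2 - 2 * N - 1)\<^sup>2 - 1/2 + 80000 * N ^ 3 * \<tau> \<ge> 0"
\<comment> \<open>Above this threshold the last term alone is at least \<open>1/2\<close>.\<close>
proof (cases "N ^ 3 * \<tau> \<ge> 1/160000")
  case True
  then have "80000 * N ^ 3 * \<tau> \<ge> 1/2" by simp
  then show ?thesis by (smt (verit) zero_le_power2)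
next
  case False
  have \<tau>0: "\<tau> \<ge> 0" unfolding \<tau> by (intro sum_nonneg) auto
  have "N \<le> N\<^sup>2" using sum_power4_le_square [OF fin, of s] N by simp
  then have N1: "N \<ge> 1" using N(3) by (simp add: power2_eq_square)
  have \<tau>1: "\<tau> \<le> 1/160000"
  proof -
    have "1 * \<tau> \<le> N ^ 3 * \<tau>" using N1 \<tau>0 by (intro mult_right_mono) (auto simp: one_le_power)
    then show ?thesis using False by simp
  qed
  \<comment> \<open>\<open>k\<close> counts the terms with \<open>s i ^ 2 \<ge> 1/2\<close>, and
    \<open>j\<close> counts them with sign. Both are integers, so that parity applies.\<close>
  define k :: int where "k = (\<Sum>i\<in>I. of_bool (s i ^ 2 \<ge> 1/2))"
  define j :: int where "j = (\<Sum>i\<in>I. of_bool (s i ^ 2 \<ge> 1/2) * (if s i > 0 then 1 else if s i = 0 then 0 else -1))"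
  have j: "of_int j = (\<Sum>i\<in>I. of_bool (s i ^ 2 \<ge> 1/2) * sgn (s i))"
    unfolding j_def of_int_sum by (intro sum.cong) (auto simp: sgn_if)
  have k: "of_int k = (\<Sum>i\<in>I. of_bool (s i ^ 2 \<ge> 1/2) :: real)"
    by (simp add: k_def)
  have Nk: "\<bar>N - of_int k\<bar> \<le> 8 * \<tau>"
  proof -
    have "N - of_int k = 2 * N - N - of_int k" by simp
    also have "\<dots> = (\<Sum>i\<in>I. 2 * s i ^ 2 - s i ^ 4 - of_bool (s i ^ 2 \<ge> 1/2))"
      unfolding sum_subtractf k by (subst N(1), subst N(2)) (simp add: sum_distrib_left)
    also have "\<bar>\<dots>\<bar> \<le> (\<Sum>i\<in>I. 8 * ((s i)\<^sup>2 * ((s i)\<^sup>2 - 1)\<^sup>2))"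
      by (intro order_trans [OF sum_abs] sum_mono count_error)
    finally show ?thesis by (simp add: \<tau> sum_distrib_left)
  qed
  \<comment> \<open>This choice makes \<open>9 * N * (\<epsilon> * N + \<tau> / \<epsilon>)\<close>
    equal to \<open>9/400 + 3600 * N^3 * \<tau>\<close>, which is below
    \<open>9/200\<close>.\<close>
  define \<epsilon> where "\<epsilon> = 1 / (400 * N\<^sup>2)"
  have \<epsilon>: "0 < \<epsilon>" "\<epsilon> \<le> 1"
  proof -
    have "1 \<le> N\<^sup>2" using N1 by (rule one_le_power)
    then have "1 \<le> 400 * N\<^sup>2" by linarith
    then show "0 < \<epsilon>" "\<epsilon> \<le> 1" unfolding \<epsilon>_def using N1 by (auto simp: divide_le_eq)
  qed
  have Sj: "\<bar>S - of_int j\<bar> \<le> 3 * (\<epsilon> * N + \<tau> / \<epsilon>)"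
  proof -
    have "S - of_int j = (\<Sum>i\<in>I. s i ^ 3 - of_bool (s i ^ 2 \<ge> 1/2) * sgn (s i))"
      by (simp add: S j sum_subtractf)
    also have "\<bar>\<dots>\<bar> \<le> (\<Sum>i\<in>I. 3 * (\<epsilon> * (s i)\<^sup>2 + (s i)\<^sup>2 * ((s i)\<^sup>2 - 1)\<^sup>2 / \<epsilon>))"
      by (intro order_trans [OF sum_abs] sum_mono cube_error \<epsilon>)
    also have "\<dots> = 3 * (\<epsilon> * N + \<tau> / \<epsilon>)"
      unfolding N(1) \<tau> by (simp add: sum.distrib sum_distrib_left sum_divide_distrib)
    finally show ?thesis .
  qed
  have SN: "\<bar>S\<bar> \<le> N"
  proof -
    have "\<bar>S\<bar> \<le> (\<Sum>i\<in>I. (s i ^ 2 + s i ^ 4) / 2)"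
      unfolding S
    proof (intro order_trans [OF sum_abs] sum_mono)
      fix i
      define u where "u = \<bar>s i\<bar>"
      have u: "s i ^ 2 = u ^ 2" "s i ^ 4 = u ^ 4" "\<bar>s i ^ 3\<bar> = u ^ 3" by (simp_all add: u_def power_abs)
      have "0 \<le> (u - u ^ 2)\<^sup>2" by simp
      also have "\<dots> = s i ^ 2 + s i ^ 4 - 2 * \<bar>s i ^ 3\<bar>"
        unfolding u by (simp add: power2_eq_square power3_eq_cube power4_eq_xxxx algebra_simps)
      finally show "\<bar>s i ^ 3\<bar> \<le> (s i ^ 2 + s i ^ 4) / 2" by simp
    qed
    also have "\<dots> = N" using N by (simp add: sum.distrib flip: sum_divide_distrib)
    finally show ?thesis .
  qed
  have jk: "\<bar>of_int j\<bar> \<le> (of_int k :: real)"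
    unfolding j k by (intro order_trans [OF sum_abs] sum_mono) (auto simp: abs_mult sgn_if)
  have "\<bar>S\<^sup>2 - of_int (j\<^sup>2)\<bar> \<le> 1/20"
  proof -
    have "S\<^sup>2 - of_int (j\<^sup>2) = (S - of_int j) * (S + of_int j)"
      by (simp add: power2_eq_square algebra_simps)
    then have "\<bar>S\<^sup>2 - of_int (j\<^sup>2)\<bar> = \<bar>S - of_int j\<bar> * \<bar>S + of_int j\<bar>" by (simp add: abs_mult)
    also have "\<dots> \<le> 3 * (\<epsilon> * N + \<tau> / \<epsilon>) * (3 * N)"
    proof (intro mult_mono Sj)
      \<comment> \<open>The sum is at most \<open>N + k\<close>, and \<open>k\<close> exceeds
        \<open>N\<close> by at most \<open>8 * \<tau>\<close>, which is less than
        \<open>N\<close>.\<close>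
      show "\<bar>S + of_int j\<bar> \<le> 3 * N" using SN jk Nk \<tau>1 N1 by linarith
      show "0 \<le> 3 * (\<epsilon> * N + \<tau> / \<epsilon>)" using \<epsilon> \<tau>0 N1 by simp
    qed simp
    also have "\<dots> = 9 / 400 + 3600 * (N ^ 3 * \<tau>)"
      using N1 by (simp add: \<epsilon>_def field_simps power2_eq_square power3_eq_cube)
    also have "\<dots> \<le> 1/20" using False by simp
    finally show ?thesis .
  qed
  moreover have "\<bar>N - of_int k\<bar> \<le> 1/20" using Nk \<tau>1 by simp
  moreover have "\<bar>2 * of_int (j\<^sup>2) - 2 * of_int k - 1\<bar> \<ge> (1::real)"
  proof -
    have "\<bar>2 * j\<^sup>2 - 2 * k - 1\<bar> \<ge> 1" by presburger
    then have "of_int \<bar>2 * j\<^sup>2 - 2 * k - 1\<bar> \<ge> (1::real)" by linarith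
    then show ?thesis by simp
  qed
  \<comment> \<open>An odd integer has absolute value at least \<open>1\<close>, and the two doubled
    errors of \<open>1/20\<close> take away at most \<open>2/10\<close>.\<close>
  ultimately have "\<bar>2 * S\<^sup>2 - 2 * N - 1\<bar> \<ge> 8/10" by linarith
  then have "(8/10)\<^sup>2 \<le> \<bar>2 * S\<^sup>2 - 2 * N - 1\<bar>\<^sup>2" by (intro power_mono) auto
  then have "1/2 \<le> (2 * S\<^sup>2 - 2 * N - 1)\<^sup>2" by (simp add: power2_eq_square)
  moreover have "0 \<le> 80000 * N ^ 3 * \<tau>" using N1 \<tau>0 by simp
  ultimately show ?thesis by linarith
qed

text \<open>Rescaling by \<open>r\<close> makes the second and fourth power sums equal, and the
  expression becomes \<open>p 4 ^ 6\<close> times the normalized one, up to a power of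
  \<open>p 2\<close> in the last term.\<close>

lemma power_sum_inequality:
  fixes x :: "'a \<Rightarrow> real"
  assumes fin: "finite I"
  defines "p \<equiv> \<lambda>k. \<Sum>i\<in>I. x i ^ k"
  assumes "p 2 \<le> 1"
  shows "(2 * p 3 ^ 2 * p 2 ^ 3 - 2 * p 2 ^ 2 * p 4 ^ 2 - p 4 ^ 3)\<^sup>2 - p 4 ^ 6 / 2
    + 80000 * (p 2 * p 6 - p 4 ^ 2) \<ge> 0"
proof (cases "\<exists>i\<in>I. x i \<noteq> 0")
  case False
  then have "p 2 = 0" "p 4 = 0" by (auto simp: p_def)
  then show ?thesis by simp
next
  case True
  then obtain i where i: "i \<in> I" "x i \<noteq> 0" by blast
  have p2: "p 2 > 0" unfolding p_def using i by (intro sum_pos2 [OF fin]) auto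
  have p4: "p 4 > 0" unfolding p_def using i by (intro sum_pos2 [OF fin]) auto
  define r where "r = sqrt (p 4 / p 2)"
  have r: "r > 0" "r\<^sup>2 = p 4 / p 2" using p2 p4 by (simp_all add: r_def)
  have p4r: "p 4 = r\<^sup>2 * p 2" using r p2 by simp
  define s where "s = (\<lambda>i. x i / r)"
  define N where "N = p 2 / r\<^sup>2"
  define S where "S = p 3 / r ^ 3"
  define \<tau> where "\<tau> = p 6 / r ^ 6 - N"
  have sk: "(\<Sum>i\<in>I. s i ^ k) = p k / r ^ k" for k
    by (simp add: s_def p_def power_divide sum_divide_distrib)
  have Ns: "N = (\<Sum>i\<in>I. s i ^ 2)" "N = (\<Sum>i\<in>I. s i ^ 4)"
    unfolding sk N_def p4r using r(1) by (simp_all add: field_simps flip: power_add)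
  have N0: "N > 0" using p2 r(1) by (simp add: N_def)
  have \<tau>s: "\<tau> = (\<Sum>i\<in>I. (s i)\<^sup>2 * ((s i)\<^sup>2 - 1)\<^sup>2)"
  proof -
    have "(\<Sum>i\<in>I. (s i)\<^sup>2 * ((s i)\<^sup>2 - 1)\<^sup>2) = (\<Sum>i\<in>I. s i ^ 6 - 2 * s i ^ 4 + s i ^ 2)"
      by (intro sum.cong) (auto simp: power2_eq_square power4_eq_xxxx eval_nat_numeral algebra_simps)
    also have "\<dots> = (\<Sum>i\<in>I. s i ^ 6) - 2 * N + N"
      unfolding sum.distrib sum_subtractf by (subst Ns(2), subst Ns(1)) (simp add: sum_distrib_left)
    finally show ?thesis by (simp add: sk \<tau>_def)
  qed
  have main: "(2 * S\<^sup>2 - 2 * N - 1)\<^sup>2 - 1/2 + 80000 * N ^ 3 * \<tau> \<ge> 0"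
    by (rule normalized_inequality [OF fin Ns N0 _ \<tau>s]) (simp add: sk S_def)
  have P: "p 2 * p 6 - p 4 ^ 2 = p 2 * r ^ 6 * \<tau>"
    unfolding \<tau>_def N_def p4r using r(1) by (simp add: field_simps power2_eq_square eval_nat_numeral)
  have \<tau>0: "\<tau> \<ge> 0" unfolding \<tau>s by (intro sum_nonneg) auto
  have e1: "2 * p 3 ^ 2 * p 2 ^ 3 - 2 * p 2 ^ 2 * p 4 ^ 2 - p 4 ^ 3 = p 4 ^ 3 * (2 * S\<^sup>2 - 2 * N - 1)"
    unfolding S_def N_def p4r using r(1) by (simp add: field_simps power2_eq_square eval_nat_numeral)
  have e2: "p 4 ^ 6 * (N ^ 3 * \<tau>) = p 2 ^ 8 * (p 2 * p 6 - p 4 ^ 2)"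
    unfolding P unfolding N_def p4r using r(1) by (simp add: field_simps power2_eq_square eval_nat_numeral)
  have "0 \<le> p 4 ^ 6 * ((2 * S\<^sup>2 - 2 * N - 1)\<^sup>2 - 1/2 + 80000 * N ^ 3 * \<tau>)"
    using main by simp
  also have "\<dots> = (p 4 ^ 3 * (2 * S\<^sup>2 - 2 * N - 1))\<^sup>2 - p 4 ^ 6 / 2 + 80000 * (p 4 ^ 6 * (N ^ 3 * \<tau>))"
    unfolding power_mult_distrib power_mult [symmetric] by (simp add: algebra_simps)
  also have "\<dots> = (2 * p 3 ^ 2 * p 2 ^ 3 - 2 * p 2 ^ 2 * p 4 ^ 2 - p 4 ^ 3)\<^sup>2 - p 4 ^ 6 / 2
    + 80000 * (p 2 ^ 8 * (p 2 * p 6 - p 4 ^ 2))"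
    unfolding e1 e2 ..
  \<comment> \<open>Here \<open>p 2 \<le> 1\<close> enters: the last term lacks the factor
    \<open>p 2 ^ 8\<close> that homogeneity would demand.\<close>
  also have "p 2 ^ 8 * (p 2 * p 6 - p 4 ^ 2) \<le> 1 * (p 2 * p 6 - p 4 ^ 2)"
    using assms(3) p2 \<tau>0 r(1) unfolding P by (intro mult_right_mono power_le_one) auto
  finally show ?thesis by simp
qed

section \<open>The separating element\<close>

text \<open>A named combination lets the rules for \<open>lin\<close> and
  \<open>unlabeled_el\<close> match without higher-order unification.\<close>

definition lc :: "real \<Rightarrow> (plg \<Rightarrow> real) \<Rightarrow> real \<Rightarrow> (plg \<Rightarrow> real) \<Rightarrow> plg \<Rightarrow> real" where
  "lc a f b g = (\<lambda>X. a * f X + b * g X)"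

definition separating_base :: "plg \<Rightarrow> real" where
  "separating_base =
    (let c = \<lambda>k. delta (cyc k) in
     lc 1 (lc 2 (pmul (pmul (c 3) (c 3)) (pmul (c 2) (pmul (c 2) (c 2))))
           (- 2) (pmul (pmul (c 2) (c 2)) (pmul (c 4) (c 4))))
        (- 1) (pmul (c 4) (pmul (c 4) (c 4))))"

definition separating :: "plg \<Rightarrow> real" where
  "separating =
    (let c = \<lambda>k. delta (cyc k); c4_cubed = pmul (c 4) (pmul (c 4) (c 4)) in
     lc 1 (lc 1 (pmul separating_base separating_base) (- 1/2) (pmul c4_cubed c4_cubed))
        80000 (lc 1 (pmul (c 2) (c 6)) (- 1) (pmul (c 4) (c 4))))"

definition unlabeled_el :: "(plg \<Rightarrow> real) \<Rightarrow> bool" where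
  "unlabeled_el f \<longleftrightarrow> is_el f \<and> in_FL {} f"

lemma unlabeled_el_cyc: "k \<ge> 2 \<Longrightarrow> unlabeled_el (delta (cyc k))"
  using in_FL_delta [of "cyc k"] by (simp add: unlabeled_el_def is_el_delta wf_cyc labels_cyc)

lemma unlabeled_el_pmul: "unlabeled_el f \<Longrightarrow> unlabeled_el g \<Longrightarrow> unlabeled_el (pmul f g)"
  by (simp add: unlabeled_el_def is_el_pmul in_FL_pmul)

lemma unlabeled_el_lc: "unlabeled_el f \<Longrightarrow> unlabeled_el g \<Longrightarrow> unlabeled_el (lc a f b g)"
  by (simp add: unlabeled_el_def lc_def is_el_lincomb in_FL_lincomb)

lemma unlabeled_el_separating_base: "unlabeled_el separating_base"
  unfolding separating_base_def Let_def
  by (intro unlabeled_el_lc unlabeled_el_pmul unlabeled_el_cyc) auto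

lemma unlabeled_el_separating: "unlabeled_el separating"
  unfolding separating_def Let_def
  by (intro unlabeled_el_lc unlabeled_el_pmul unlabeled_el_separating_base unlabeled_el_cyc) auto

text \<open>Stated for any multiplicative \<open>v\<close>, since it is applied both to densities in
  graphs and to \<open>ev\<close> at a real \<open>N\<close>.\<close>

lemma lin_separating:
  assumes "\<And>H H'. wf_plg H \<Longrightarrow> wf_plg H' \<Longrightarrow> v (plg_mult H H') = v H * v H'"
  defines "p \<equiv> \<lambda>k. v (cyc k)"
  shows "lin v separating = (2 * p 3 ^ 2 * p 2 ^ 3 - 2 * p 2 ^ 2 * p 4 ^ 2 - p 4 ^ 3)\<^sup>2 - p 4 ^ 6 / 2
    + 80000 * (p 2 * p 6 - p 4 ^ 2)"
proof -
  have mul: "lin v (pmul f g) = lin v f * lin v g" if "unlabeled_el f" "unlabeled_el g" for f g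
    using that assms(1) by (intro lin_pmul) (auto simp: unlabeled_el_def is_el_def)
  have add: "lin v (lc a f b g) = a * lin v f + b * lin v g" if "unlabeled_el f" "unlabeled_el g" for a b f g
    unfolding lc_def using that by (intro lin_lincomb) (auto simp: unlabeled_el_def is_el_def)
  note el = unlabeled_el_lc unlabeled_el_pmul unlabeled_el_cyc unlabeled_el_separating_base
  have cyc: "lin v (delta (cyc k)) = p k" for k by (simp add: p_def lin_delta)
  have base: "lin v separating_base = 2 * p 3 ^ 2 * p 2 ^ 3 - 2 * p 2 ^ 2 * p 4 ^ 2 - p 4 ^ 3"
    unfolding separating_base_def Let_def
    by (simp add: mul add el cyc) (simp add: eval_nat_numeral algebra_simps)
  show ?thesis
    unfolding separating_def Let_def
    by (simp add: mul add el cyc base) (simp add: eval_nat_numeral algebra_simps)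
qed

section \<open>Positivity and underivability\<close>

lemma tdens_le_1:
  assumes "wf_plg H" "finite VG" "VG \<noteq> {}"
  shows "tdens H VG EG \<phi> \<le> 1"
proof -
  let ?U = "unlabeled_vertices H"
  have "card (homs H VG EG \<phi>) \<le> card (?U \<rightarrow>\<^sub>E VG)"
    using assms by (intro card_mono finite_PiE) (auto simp: homs_def finite_unlabeled_vertices)
  also have "\<dots> = card VG ^ card ?U" using assms by (simp add: card_PiE finite_unlabeled_vertices)
  finally have "real (card (homs H VG EG \<phi>)) \<le> real (card VG) ^ card ?U"
    by (metis of_nat_le_iff of_nat_power)
  then show ?thesis using assms by (simp add: tdens_homs divide_le_eq_1_pos card_gt_0_iff)
qed

text \<open>The cycle densities are the power sums of the adjacency eigenvalues divided by
  \<open>card VG\<close>.\<close>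

lemma positive_separating: "positive {} separating"
  unfolding positive_def
proof (intro allI impI)
  fix VG EG and \<phi> :: "nat \<Rightarrow> nat"
  assume "sgraph VG EG \<and> VG \<noteq> {} \<and> \<phi> ` {} \<subseteq> VG"
  then have VG: "finite VG" "VG \<noteq> {}" by (auto simp: sgraph_def)
  have "adj EG x y = adj EG y x" for x y by (simp add: adj_def insert_commute)
  from walks_power_sum [OF VG(1), of "adj EG", OF this] obtain \<mu> :: "nat \<Rightarrow> real" where
    \<mu>: "\<And>k. (\<Sum>x\<in>VG. walks (adj EG) VG k x x) = (\<Sum>i<card VG. \<mu> i ^ k)" by blast
  let ?p = "\<lambda>k. \<Sum>i<card VG. (\<mu> i / card VG) ^ k"
  have p: "tdens (cyc k) VG EG \<phi> = ?p k" if "k \<ge> 1" for k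
  proof -
    obtain k' where k: "k = Suc k'" using \<open>k \<ge> 1\<close> by (cases k) auto
    show ?thesis unfolding k tdens_cyc [OF VG(1)] \<mu>
      by (simp only: power_divide sum_divide_distrib)
  qed
  have "?p 2 \<le> 1" using tdens_le_1 [OF wf_cyc VG, of 2 EG \<phi>] p [of 2] by simp
  then have "0 \<le> (2 * ?p 3 ^ 2 * ?p 2 ^ 3 - 2 * ?p 2 ^ 2 * ?p 4 ^ 2 - ?p 4 ^ 3)\<^sup>2 - ?p 4 ^ 6 / 2
    + 80000 * (?p 2 * ?p 6 - ?p 4 ^ 2)"
    by (intro power_sum_inequality) auto
  also have "\<dots> = lin (\<lambda>H. tdens H VG EG \<phi>) separating"
    by (subst lin_separating) (simp_all add: tdens_plg_mult p)
  finally show "tdens_el separating VG EG \<phi> \<ge> 0" by (simp add: tdens_el_def lin_def)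
qed

lemma separating_notin_CSpos: "separating \<notin> CSpos"
proof
  assume "separating \<in> CSpos"
  then obtain K :: nat where
    K: "\<And>n \<phi> N::real. N > 0 \<Longrightarrow> N \<ge> 2 * n + K \<Longrightarrow> lin (\<lambda>H. ev n H \<phi> N) separating \<ge> 0"
    using CSpos_sound by blast
  \<comment> \<open>Large enough for \<nu>, which is at least \<open>sqrt n\<close>, to be at least
    \<open>K\<close>.\<close>
  define n where "n = K\<^sup>2 + 1"
  \<comment> \<open>The positive root of \<open>2 * \<nu>^2 - 2 * (2 * n + \<nu>) - 1\<close>. It is
    not an integer, as \<open>8 * n + 3\<close> is never a square.\<close>
  define \<nu> where "\<nu> = (1 + sqrt (8 * real n + 3)) / 2"
  define N where "N = 2 * real n + \<nu>"
  have "real K \<le> \<nu>"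
  proof -
    have "real K \<le> sqrt (real n)" by (intro real_le_rsqrt) (simp add: n_def)
    also have "\<dots> = sqrt (4 * real n) / 2" by (simp add: real_sqrt_mult)
    also have "\<dots> \<le> sqrt (8 * real n + 3) / 2" by simp
    finally show ?thesis by (simp add: \<nu>_def add_divide_distrib)
  qed
  moreover have "\<nu> > 0" by (simp add: \<nu>_def add_pos_nonneg)
  ultimately have N: "N > 0" "N \<ge> 2 * n + K" by (simp_all add: N_def)
  have \<nu>: "2 * \<nu>\<^sup>2 - 2 * N - 1 = 0"
  proof -
    have "2 * \<nu> - 1 = sqrt (8 * real n + 3)" by (simp add: \<nu>_def field_simps)
    then have "(2 * \<nu> - 1)\<^sup>2 = 8 * real n + 3" by simp
    then show ?thesis by (simp add: N_def power2_eq_square algebra_simps)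
  qed
  let ?p = "\<lambda>k. ev n (cyc k) (\<lambda>_. 0) N"
  have p: "?p 2 = 1 / N" "?p 3 = \<nu> / N ^ 3" "?p 4 = 1 / N ^ 3" "?p 6 = 1 / N ^ 5"
    using N(1) by (simp_all add: ev_cyc) (simp_all add: N_def power_eq_if)
  have "2 * ?p 3 ^ 2 * ?p 2 ^ 3 - 2 * ?p 2 ^ 2 * ?p 4 ^ 2 - ?p 4 ^ 3 = (2 * \<nu>\<^sup>2 - 2 * N - 1) / N ^ 9"
    unfolding p using N(1) by (simp add: field_simps eval_nat_numeral)
  then have "2 * ?p 3 ^ 2 * ?p 2 ^ 3 - 2 * ?p 2 ^ 2 * ?p 4 ^ 2 - ?p 4 ^ 3 = 0" by (simp add: \<nu>)
  \<comment> \<open>The equality case: formally, all normalized eigenvalues have absolute value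
    \<open>1 / N\<close>.\<close>
  moreover have "?p 2 * ?p 6 - ?p 4 ^ 2 = 0"
    unfolding p using N(1) by (simp add: field_simps eval_nat_numeral)
  moreover have "lin (\<lambda>H. ev n H (\<lambda>_. 0) N) separating
      = (2 * ?p 3 ^ 2 * ?p 2 ^ 3 - 2 * ?p 2 ^ 2 * ?p 4 ^ 2 - ?p 4 ^ 3)\<^sup>2 - ?p 4 ^ 6 / 2
        + 80000 * (?p 2 * ?p 6 - ?p 4 ^ 2)"
    by (rule lin_separating) (rule ev_plg_mult [OF _ _ N(1)])
  ultimately have "lin (\<lambda>H. ev n H (\<lambda>_. 0) N) separating = - (?p 4 ^ 6 / 2)" by simp
  also have "\<dots> < 0" unfolding p using N(1) by simp
  finally show False using K [OF N, of "\<lambda>_. 0"] by simp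
qed

theorem theorem2p7:
  shows "\<exists>f. is_el f \<and> in_FL {} f \<and> positive {} f \<and> f \<notin> CSpos"
  using unlabeled_el_separating positive_separating separating_notin_CSpos
  unfolding unlabeled_el_def by blast

end
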